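(* Let $d\ge1$, $\Omega=[0,1]^d$, $T\in\mathbb{R}$, let $X$ be an $\Omega$-valued random variable and $g:\Omega\to\mathbb{R}$ a function such that: (1) the law of $X$ has a bounded density $f_X$ with respect to the Lebesgue measure $\lambda$ on $\Omega$; (2) $|g(x)-g(\tilde x)|\le L\|x-\tilde x\|_\infty$ for all $x,\tilde x\in\Omega$; (3) there is $M>0$ with $\lambda(\{x\in\Omega:|g(x)-T|\le\delta\})\le M\delta$ for all $\delta>0$; (4) $p:=\mathbb{P}(g(X)>T)\in(0,1)$. Let $n\ge1$ and let $p_n^-\le p\le p_n^+$ be the deterministic bounds produced from $n$ evaluations of $g$ by the recursive dyadic algorithm described in the context. Suppose that for each dyadic cube $Q$ of $\Omega$ with $\mathbb{P}(X\in Q)>0$ one has, for every $N$, an i.i.d. sample of size $N$ from the law of $X$ given $X\in Q$, the samples for different cubes being independent. Then, without any additional call to $g$, the estimators $p_{n,N}^-$ and $p_{n,N}^+$ built from these samples (defined in the context) are unbiased and strongly consistent estimators of $p_n^-$ and $p_n^+$ respectively, i.e. $\mathbb{E}[p_{n,N}^\pm]=p_n^\pm$ and $p_{n,N}^\pm\to p_n^\pm$ almost surely as $N\to\infty$, and they are asymptotically Gaussian: for some $\sigma_n^\pm\ge0$, $$\sqrt N\,\bigl(p_{n,N}^\pm-p_n^\pm\bigr)\xrightarrow[N\to\infty]{d}\mathcal N\bigl(0,(\sigma_n^\pm)^2\bigr).$$ Moreover the estimators $\sigma_{n,N}^-$ and $\sigma_{n,N}^+$ (defined in the context) built from the same samples,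 again with no additional call to $g$, are consistent estimators of $\sigma_n^-$ and $\sigma_n^+$.
   Context: Dyadic cubes and tree. The dyadic cubes of $\Omega$ are the closed cubes $\prod_{i=1}^d[m_i2^{-j},(m_i+1)2^{-j}]$, $j\ge0$, $0\le m_i<2^j$; $c_Q$ is the center of $Q$. They are identified with the vertices of the infinite $2^d$-regular tree $\mathcal T$: the root $\emptyset$ is $\Omega$, and the $2^d$ children of a cube of side $2^{-j}$ are the dyadic subcubes of side $2^{-j-1}$ it contains. $Q(u)$ is the cube of vertex $u$, $\bar v$ the parent of $v\ne\emptyset$; $v\le u$ means $Q(u)\subset Q(v)$; $a(u)=\{v: v\le u, v\neq\emptyset\}$ (it includes $u$ if $u\ne\emptyset$, and excludes the root); $u\wedge u'$ is the deepest common ancestor of $u$ and $u'$. Labels. A cube $Q$ of side $2^{-j}$ has label $\mathcal I$ if $g(c_Q)>T+L2^{-j-1}$, label $\mathcal O$ if $g(c_Q)<T-L2^{-j-1}$, and label $\mathcal U$ otherwise. Trees. $\Lambda(0)=\{\Omega\}$, and $\Omega$ has label $\mathcal U$ (no evaluation needed). Given $\Lambda(k)$, the tree $\Lambda(k+1)$ is obtained by adding the $2^d$ children of each leaf of $\Lambda(k)$ labelled $\mathcal U$ and labelling them by evaluating $g$ at their centers. Let $\mathcal I(k)$, $\mathcal U(k)$ be the sets of leaves of $\Lambda(k)$ with label $\mathcal I$, $\mathcal U$, and $n_k=|\Lambda(k)|-1$ the number of evaluations of $g$ used. Given $n\ge1$, let $k$ be such that $n_k\le n<n_{k+1}$. The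 algorithm with budget $n$ builds $\Lambda(k)$ and then evaluates $g$ at the centers of only $n-n_k$ of the depth-$(k+1)$ vertices of $\Lambda(k+1)$ (in some fixed order). $\mathcal I_n$ consists of $\mathcal I(k)$ and the evaluated depth-$(k+1)$ vertices with label $\mathcal I$; $\mathcal U_n$ consists of the evaluated depth-$(k+1)$ vertices with label $\mathcal U$ and the children not evaluated of cubes in $\mathcal U(k)$. Then $$p_n^-:=\sum_{Q\in\mathcal I_n}\mathbb P(X\in Q),\qquad p_n^+:=p_n^-+\sum_{Q\in\mathcal U_n}\mathbb P(X\in Q).$$ Estimators. For each vertex $v$ with $\mathbb P(X\in Q(v))>0$, $(X_i^v)_{i\ge1}$ is an i.i.d. sequence with the law of $X$ given $X\in Q(v)$, these sequences being independent for different $v$. Put $$q_N(v)=\frac1N\sum_{i=1}^N\mathbf 1_{\{X_i^{\bar v}\in Q(v)\}},\qquad p_N(u)=\prod_{v\in a(u)}q_N(v),\qquad p_N(\mathcal S)=\sum_{u\in\mathcal S}p_N(u)$$ for a finite set $\mathcal S$ of vertices, where vertices $u$ with $\mathbb P(X\in Q(u))=0$ are removed from $\mathcal S$. Then $p_{n,N}^-:=p_N(\mathcal I_n)$ and $p_{n,N}^+:=p_N(\mathcal I_n\cup\mathcal U_n)$. Further, $\sigma_{n,N}^-$ and $\sigma_{n,N}^+$ are the nonnegative square roots of $\sigma_N^2(\mathcal S)$ for $\mathcal S=\mathcal I_n$ and $\mathcal S=\mathcal I_n\cup\mathcal U_n$ respectively, where $$\sigma_N^2(\mathcal S)=\sum_{u\in\mathcal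 S}p_N(u)^2\sum_{v\in a(u)}\frac{1-q_N(v)}{q_N(v)}+\sum_{u,u'\in\mathcal S,\ u\ne u'}p_N(u)p_N(u')\Bigl[\sum_{v\in a(u\wedge u')}\frac{1-q_N(v)}{q_N(v)}-1\Bigr],$$ the second sum being over ordered pairs, and any term with $p_N(u)=0$ or $p_N(u')=0$ being read as $0$. *)

theory Defs
  imports "HOL-Probability.Probability"
begin

definition unit_cube :: "(real ^ 'd::finite) set" where
  "unit_cube = cbox 0 1"

text \<open>
  The vertex \<open>(j, m)\<close> encodes the dyadic cube with side \<open>2\<^sup>-\<^sup>j\<close> and lower corner \<open>m / 2\<^sup>j\<close>.
  The encoding is injective, so vertices and dyadic cubes may be identified.
\<close>

type_synonym 'd vertex = "nat \<times> (nat ^ 'd)"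

definition vertices :: "'d::finite vertex set" where
  "vertices = {(j, m). \<forall>i. m $ i < 2 ^ j}"

definition depth :: "'d::finite vertex \<Rightarrow> nat" where
  "depth v = fst v"

definition root_vertex :: "'d::finite vertex" where
  "root_vertex = (0, 0)"

definition cube :: "'d::finite vertex \<Rightarrow> (real ^ 'd) set" where
  "cube v = (case v of (j, m) \<Rightarrow>
     cbox (\<chi> i. real (m $ i) / 2 ^ j) (\<chi> i. (real (m $ i) + 1) / 2 ^ j))"

definition centre :: "'d::finite vertex \<Rightarrow> real ^ 'd" where
  "centre v = (case v of (j, m) \<Rightarrow> \<chi> i. (real (m $ i) + 1 / 2) / 2 ^ j)"

definition children :: "'d::finite vertex \<Rightarrow> 'd vertex set" where
  "children v = {u \<in> vertices. depth u = Suc (depth v) \<and> cube u \<subseteq> cube v}"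

definition parent :: "'d::finite vertex \<Rightarrow> 'd vertex" where
  "parent u = (THE v. v \<in> vertices \<and> u \<in> children v)"

definition anc_le :: "'d::finite vertex \<Rightarrow> 'd vertex \<Rightarrow> bool" where
  "anc_le v u \<longleftrightarrow> cube u \<subseteq> cube v"

definition ancestors :: "'d::finite vertex \<Rightarrow> 'd vertex set" where
  "ancestors u = {v \<in> vertices. anc_le v u \<and> v \<noteq> root_vertex}"

definition common_ancestor :: "'d::finite vertex \<Rightarrow> 'd vertex \<Rightarrow> 'd vertex" where
  "common_ancestor u u' = (ARG_MAX depth w. w \<in> vertices \<and> anc_le w u \<and> anc_le w u')"

datatype label = Inside | Outside | Undecided

text \<open>
  The root is undecided by convention, without evaluating \<open>g\<close>.
\<close>

definition label_of :: "(real ^ 'd::finite \<Rightarrow> real) \<Rightarrow> real \<Rightarrow> real \<Rightarrow> 'd vertex \<Rightarrow> label" where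
  "label_of g T L v =
     (if v = root_vertex then Undecided
      else if g (centre v) > T + L / 2 ^ (depth v + 1) then Inside
      else if g (centre v) < T - L / 2 ^ (depth v + 1) then Outside
      else Undecided)"

definition leaves :: "'d::finite vertex set \<Rightarrow> 'd vertex set" where
  "leaves A = {v \<in> A. children v \<inter> A = {}}"

primrec tree :: "(real ^ 'd::finite \<Rightarrow> real) \<Rightarrow> real \<Rightarrow> real \<Rightarrow> nat \<Rightarrow> 'd vertex set" where
  "tree g T L 0 = {root_vertex}"
| "tree g T L (Suc k) = tree g T L k \<union>
     (\<Union>v \<in> {v \<in> leaves (tree g T L k). label_of g T L v = Undecided}. children v)"

definition labelled_leaves ::
  "(real ^ 'd::finite \<Rightarrow> real) \<Rightarrow> real \<Rightarrow> real \<Rightarrow> label \<Rightarrow> nat \<Rightarrow> 'd vertex set" where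
  "labelled_leaves g T L l k = {v \<in> leaves (tree g T L k). label_of g T L v = l}"

definition num_evals :: "(real ^ 'd::finite \<Rightarrow> real) \<Rightarrow> real \<Rightarrow> real \<Rightarrow> nat \<Rightarrow> nat" where
  "num_evals g T L k = card (tree g T L k) - 1"

definition new_vertices :: "(real ^ 'd::finite \<Rightarrow> real) \<Rightarrow> real \<Rightarrow> real \<Rightarrow> nat \<Rightarrow> 'd vertex set" where
  "new_vertices g T L j = {v \<in> tree g T L j. depth v = j}"

definition budget_level :: "(real ^ 'd::finite \<Rightarrow> real) \<Rightarrow> real \<Rightarrow> real \<Rightarrow> nat \<Rightarrow> nat" where
  "budget_level g T L n = (THE k. num_evals g T L k \<le> n \<and> n < num_evals g T L (Suc k))"

text \<open>
  The order in which the last generation is evaluated is a parameter: \<open>enum j\<close> lists the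
  vertices of \<open>new_vertices g T L j\<close>, each exactly once.
\<close>

definition evaluated ::
  "(real ^ 'd::finite \<Rightarrow> real) \<Rightarrow> real \<Rightarrow> real \<Rightarrow> (nat \<Rightarrow> 'd vertex list) \<Rightarrow> nat \<Rightarrow> 'd vertex set" where
  "evaluated g T L enum n =
     (let k = budget_level g T L n in set (take (n - num_evals g T L k) (enum (Suc k))))"

definition inside_cubes ::
  "(real ^ 'd::finite \<Rightarrow> real) \<Rightarrow> real \<Rightarrow> real \<Rightarrow> (nat \<Rightarrow> 'd vertex list) \<Rightarrow> nat \<Rightarrow> 'd vertex set" where
  "inside_cubes g T L enum n =
     labelled_leaves g T L Inside (budget_level g T L n) \<union>
     {v \<in> evaluated g T L enum n. label_of g T L v = Inside}"

definition undecided_cubes ::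
  "(real ^ 'd::finite \<Rightarrow> real) \<Rightarrow> real \<Rightarrow> real \<Rightarrow> (nat \<Rightarrow> 'd vertex list) \<Rightarrow> nat \<Rightarrow> 'd vertex set" where
  "undecided_cubes g T L enum n =
     {v \<in> evaluated g T L enum n. label_of g T L v = Undecided} \<union>
     ((\<Union>v \<in> labelled_leaves g T L Undecided (budget_level g T L n). children v)
        - evaluated g T L enum n)"

definition cube_prob :: "'a measure \<Rightarrow> ('a \<Rightarrow> real ^ 'd::finite) \<Rightarrow> 'd vertex \<Rightarrow> real" where
  "cube_prob M X v = \<P>(\<omega> in M. X \<omega> \<in> cube v)"

definition p_lower ::
  "'a measure \<Rightarrow> ('a \<Rightarrow> real ^ 'd::finite) \<Rightarrow> (real ^ 'd \<Rightarrow> real) \<Rightarrow> real \<Rightarrow> real \<Rightarrow>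
   (nat \<Rightarrow> 'd vertex list) \<Rightarrow> nat \<Rightarrow> real" where
  "p_lower M X g T L enum n = (\<Sum>v \<in> inside_cubes g T L enum n. cube_prob M X v)"

definition p_upper ::
  "'a measure \<Rightarrow> ('a \<Rightarrow> real ^ 'd::finite) \<Rightarrow> (real ^ 'd \<Rightarrow> real) \<Rightarrow> real \<Rightarrow> real \<Rightarrow>
   (nat \<Rightarrow> 'd vertex list) \<Rightarrow> nat \<Rightarrow> real" where
  "p_upper M X g T L enum n =
     p_lower M X g T L enum n + (\<Sum>v \<in> undecided_cubes g T L enum n. cube_prob M X v)"

text \<open>
  \<open>Y v i\<close> is the \<open>i\<close>-th sample point, \<open>i \<ge> 1\<close>, of the law of \<open>X\<close> given that \<open>X\<close> lies in
  \<open>cube v\<close>; it is only meaningful if that event has positive probability.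
\<close>

definition q_est ::
  "('d::finite vertex \<Rightarrow> nat \<Rightarrow> 'a \<Rightarrow> real ^ 'd) \<Rightarrow> nat \<Rightarrow> 'd vertex \<Rightarrow> 'a \<Rightarrow> real" where
  "q_est Y N v \<omega> = 1 / real N * (\<Sum>i = 1..N. indicator (cube v) (Y (parent v) i \<omega>))"

definition p_est ::
  "('d::finite vertex \<Rightarrow> nat \<Rightarrow> 'a \<Rightarrow> real ^ 'd) \<Rightarrow> nat \<Rightarrow> 'd vertex \<Rightarrow> 'a \<Rightarrow> real" where
  "p_est Y N u \<omega> = (\<Prod>v \<in> ancestors u. q_est Y N v \<omega>)"

definition charged ::
  "'a measure \<Rightarrow> ('a \<Rightarrow> real ^ 'd::finite) \<Rightarrow> 'd vertex set \<Rightarrow> 'd vertex set" where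
  "charged M X S = {u \<in> S. cube_prob M X u > 0}"

definition p_est_set ::
  "'a measure \<Rightarrow> ('a \<Rightarrow> real ^ 'd::finite) \<Rightarrow> ('d vertex \<Rightarrow> nat \<Rightarrow> 'a \<Rightarrow> real ^ 'd) \<Rightarrow>
   nat \<Rightarrow> 'd vertex set \<Rightarrow> 'a \<Rightarrow> real" where
  "p_est_set M X Y N S \<omega> = (\<Sum>u \<in> charged M X S. p_est Y N u \<omega>)"

text \<open>
  A summand with \<open>p_est Y N u \<omega> = 0\<close> vanishes, as the convention requires; otherwise all the
  \<open>q_est Y N v \<omega>\<close> occurring in it are nonzero, so no division by zero matters.
\<close>

definition var_est_set ::
  "'a measure \<Rightarrow> ('a \<Rightarrow> real ^ 'd::finite) \<Rightarrow> ('d vertex \<Rightarrow> nat \<Rightarrow> 'a \<Rightarrow> real ^ 'd) \<Rightarrow>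
   nat \<Rightarrow> 'd vertex set \<Rightarrow> 'a \<Rightarrow> real" where
  "var_est_set M X Y N S \<omega> =
     (\<Sum>u \<in> charged M X S. (p_est Y N u \<omega>)\<^sup>2 *
        (\<Sum>v \<in> ancestors u. (1 - q_est Y N v \<omega>) / q_est Y N v \<omega>)) +
     (\<Sum>(u, u') \<in> {(u, u'). u \<in> charged M X S \<and> u' \<in> charged M X S \<and> u \<noteq> u'}.
        p_est Y N u \<omega> * p_est Y N u' \<omega> *
        ((\<Sum>v \<in> ancestors (common_ancestor u u'). (1 - q_est Y N v \<omega>) / q_est Y N v \<omega>) - 1))"

text \<open>
  The variance estimate is nonnegative whenever no sample point lies on a common face of two
  sibling cubes, that is, almost surely.
\<close>

definition sd_est_set ::
  "'a measure \<Rightarrow> ('a \<Rightarrow> real ^ 'd::finite) \<Rightarrow> ('d vertex \<Rightarrow> nat \<Rightarrow> 'a \<Rightarrow> real ^ 'd) \<Rightarrow>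
   nat \<Rightarrow> 'd vertex set \<Rightarrow> 'a \<Rightarrow> real" where
  "sd_est_set M X Y N S \<omega> = sqrt (var_est_set M X Y N S \<omega>)"

text \<open>
  The centred normal law with standard deviation \<open>\<sigma> \<ge> 0\<close>; it is the Dirac mass at \<open>0\<close> if
  \<open>\<sigma> = 0\<close>.
\<close>

definition centred_normal :: "real \<Rightarrow> real measure" where
  "centred_normal \<sigma> =
     (if \<sigma> = 0 then return borel 0 else density lborel (\<lambda>x. ennreal (normal_density 0 \<sigma> x)))"

definition tendsto_in_prob :: "'a measure \<Rightarrow> (nat \<Rightarrow> 'a \<Rightarrow> real) \<Rightarrow> real \<Rightarrow> bool" where
  "tendsto_in_prob M Z c \<longleftrightarrow>
     (\<forall>\<epsilon>>0. (\<lambda>N. \<P>(\<omega> in M. \<bar>Z N \<omega> - c\<bar> > \<epsilon>)) \<longlonglongrightarrow> 0)"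

end

theory Submission
  imports Defs
begin

text \<open>
  Write \<open>\<pi>(v)\<close> for the probability of the cube of \<open>v\<close>. Cubes whose vertices are incomparable in
  the tree overlap at most in faces, which the law of \<open>X\<close> does not charge because it has a
  density. Two things follow from the Lipschitz bound and the shape of the tree: \<open>I\<^sub>n \<union> U\<^sub>n\<close> is an
  antichain whose cubes cover \<open>{g > T}\<close>, and \<open>g > T\<close> on every cube of \<open>I\<^sub>n\<close>
  (\<open>inside_undecided_antichain\<close>, \<open>above_covered\<close>, \<open>inside_above\<close>). Additivity and subadditivity
  then give \<open>p\<^sub>n\<^sup>- \<le> p \<le> p\<^sub>n\<^sup>+\<close>, and the two bounds are the total masses of the antichains \<open>I\<^sub>n\<close>
  and \<open>I\<^sub>n \<union> U\<^sub>n\<close>. All statements about estimators hold for an arbitrary finite antichain \<open>S\<close>.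

  Along the path from the root to \<open>u\<close>, the masses telescope: \<open>\<pi>(u)\<close> is the product of the
  transition probabilities \<open>q(v) = \<pi>(v) / \<pi>(parent v)\<close> over the ancestors \<open>v\<close> of \<open>u\<close>. The
  frequency \<open>q\<^sub>N(v)\<close> is an average of indicators of mean \<open>q(v)\<close>, and frequencies along one path
  use samples of distinct parents, hence are independent. So the product \<open>p\<^sub>N(u)\<close> has mean \<open>\<pi>(u)\<close>
  (\<open>expectation_p_est\<close>), and strong consistency follows from the law of large numbers for each
  \<open>q\<^sub>N(v)\<close> (\<open>slln_bounded\<close>).

  For the central limit theorem, the product is linearised at \<open>q\<close>. The first order part of \<open>p\<^sub>N(S)
  - \<pi>(S)\<close> is the average of the first \<open>N\<close> of the i.i.d. variables \<open>influence S i = (\<Sum>u\<in>S. \<pi>(u)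
  (\<Sum>v\<in>a(u). (1{X\<^sub>i \<in> Q(v)} - q(v)) / q(v)))\<close>, where \<open>X\<^sub>i\<close> is the \<open>i\<close>-th sample point of the parent
  of \<open>v\<close>, and vertices of mass zero are removed from \<open>S\<close>. The remainder is bounded by squares of
  the \<open>q\<^sub>N(v) - q(v)\<close> (\<open>prod_linearization_error\<close>), so its mean absolute value is \<open>O(1/N)\<close> and it
  stays negligible after multiplication by the square root of \<open>N\<close>. The one-dimensional central
  limit theorem therefore carries over (\<open>clt_char\<close>, \<open>weak_conv_perturb\<close>).

  It remains to identify the variance of \<open>influence S i\<close>. The relative errors of distinct vertices
  are uncorrelated unless the vertices are siblings, and then their covariance is \<open>-1\<close> since a
  point is almost surely in at most one of the two cubes. For distinct \<open>u, u'\<close> of an antichain the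
  two paths share exactly the ancestors of \<open>u \<and> u'\<close> and contain exactly one pair of siblings, the
  place where they branch (\<open>unique_sibling_pair\<close>, \<open>sum_cov_ancestors\<close>). This accounts for the
  summand \<open>-1\<close> in the estimator of the variance, which is thus the variance of \<open>influence S i\<close>
  with \<open>q\<^sub>N\<close> in place of \<open>q\<close>; being continuous in \<open>q\<close>, it is consistent.
\<close>

section \<open>The dyadic tree\<close>

text \<open>
  In terms of the binary digits of the corner, going up the tree drops trailing digits, that is,
  divides by a power of two.
\<close>

definition ancestor_at :: "nat \<Rightarrow> 'd::finite vertex \<Rightarrow> 'd vertex" where
  "ancestor_at j u = (j, \<chi> i. snd u $ i div 2 ^ (depth u - j))"

lemma depth_ancestor_at [simp]: "depth (ancestor_at j u) = j"
  by (simp add: ancestor_at_def depth_def)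

lemma ancestor_at_self [simp]: "ancestor_at (depth u) u = u"
  by (simp add: ancestor_at_def depth_def vec_eq_iff prod_eq_iff)

lemma ancestor_at_ancestor_at:
  assumes "j \<le> k" "k \<le> depth u"
  shows "ancestor_at j (ancestor_at k u) = ancestor_at j u"
proof -
  have "depth u - j = (depth u - k) + (k - j)" using assms by simp
  then show ?thesis
    by (simp add: ancestor_at_def depth_def vec_eq_iff div_mult2_eq power_add)
qed

lemma ancestor_at_vertices:
  assumes "u \<in> vertices" "j \<le> depth u"
  shows "ancestor_at j u \<in> vertices"
proof -
  have "snd u $ i div 2 ^ (depth u - j) < 2 ^ j" for i
  proof (rule less_mult_imp_div_less)
    have "snd u $ i < 2 ^ depth u"
      using assms(1) by (auto simp: vertices_def depth_def)
    also have "(2::nat) ^ depth u = 2 ^ j * 2 ^ (depth u - j)"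
      using assms(2) by (simp flip: power_add)
    finally show "snd u $ i < 2 ^ j * 2 ^ (depth u - j)" .
  qed
  then show ?thesis by (simp add: ancestor_at_def vertices_def)
qed

text \<open>
  After scaling by \<open>2 ^ depth u\<close>, the inclusion of the cubes says in each coordinate that an integer
  interval of unit length lies in a dyadic interval, which determines the quotient of its left
  endpoint. This turns inclusion of cubes into arithmetic on vertices.
\<close>

lemma anc_le_iff: "anc_le v u \<longleftrightarrow> depth v \<le> depth u \<and> v = ancestor_at (depth v) u"
proof -
  obtain j a where v: "v = (j, a)" by fastforce
  obtain k m where u: "u = (k, m)" by fastforce
  have sub: "anc_le v u \<longleftrightarrow>
      (\<forall>i. real (a $ i) / 2 ^ j \<le> real (m $ i) / 2 ^ k \<and>
           (real (m $ i) + 1) / 2 ^ k \<le> (real (a $ i) + 1) / 2 ^ j)" (is "_ \<longleftrightarrow> ?R")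
  proof -
    have "\<forall>i. real (m $ i) / 2 ^ k \<le> (real (m $ i) + 1) / 2 ^ k"
      by (simp add: divide_right_mono)
    then show ?thesis
      by (simp add: anc_le_def u v cube_def subset_interval_cart(1))
  qed
  have scale: "real (a $ i) / 2 ^ j \<le> real (m $ i) / 2 ^ k \<and>
           (real (m $ i) + 1) / 2 ^ k \<le> (real (a $ i) + 1) / 2 ^ j
        \<longleftrightarrow> a $ i = m $ i div 2 ^ (k - j)" if "j \<le> k" for i
  proof -
    define D :: nat where "D = 2 ^ (k - j)"
    have D: "D > 0" and pow: "(2::real) ^ k = 2 ^ j * real D"
      using that by (simp_all add: D_def flip: power_add)
    have "real (a $ i) / 2 ^ j \<le> real (m $ i) / 2 ^ k \<longleftrightarrow> real (a $ i) * real D \<le> real (m $ i)"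
      using D unfolding pow by (simp add: field_simps)
    also have "\<dots> \<longleftrightarrow> a $ i * D \<le> m $ i"
      by (simp flip: of_nat_mult)
    finally have 1: "real (a $ i) / 2 ^ j \<le> real (m $ i) / 2 ^ k \<longleftrightarrow> a $ i * D \<le> m $ i" .
    have "(real (m $ i) + 1) / 2 ^ k \<le> (real (a $ i) + 1) / 2 ^ j
        \<longleftrightarrow> (real (m $ i) + 1) / real D / 2 ^ j \<le> (real (a $ i) + 1) / 2 ^ j"
      unfolding pow by (simp add: mult.commute)
    also have "\<dots> \<longleftrightarrow> real (m $ i) + 1 \<le> (real (a $ i) + 1) * real D"
      using D by (simp add: divide_le_cancel pos_divide_le_eq)
    also have "\<dots> \<longleftrightarrow> real (Suc (m $ i)) \<le> real (Suc (a $ i) * D)"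
      by (simp only: of_nat_Suc of_nat_mult) (simp add: algebra_simps)
    also have "\<dots> \<longleftrightarrow> m $ i < Suc (a $ i) * D"
      by (simp only: of_nat_le_iff Suc_le_eq)
    finally have 2: "(real (m $ i) + 1) / 2 ^ k \<le> (real (a $ i) + 1) / 2 ^ j
        \<longleftrightarrow> m $ i < Suc (a $ i) * D" .
    have "a $ i * D \<le> m $ i \<and> m $ i < Suc (a $ i) * D \<longleftrightarrow> a $ i = m $ i div D"
      using D div_nat_eqI[of D "a $ i" "m $ i"] by (auto simp: mult.commute dividend_less_times_div)
    with 1 2 show ?thesis by (simp add: D_def)
  qed
  show ?thesis
  proof (cases "j \<le> k")
    case True
    then show ?thesis
      unfolding sub using scale
      by (auto simp: u v ancestor_at_def depth_def vec_eq_iff)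
  next
    case False
    (* A cube contains no cube of larger side. *)
    have "\<not> ?R"
    proof
      assume R: ?R
      fix i :: 'a
      have "(real (m $ i) + 1) / 2 ^ k - real (m $ i) / 2 ^ k \<le>
            (real (a $ i) + 1) / 2 ^ j - real (a $ i) / 2 ^ j"
        using R by (smt (verit))
      then have "1 / 2 ^ k \<le> (1::real) / 2 ^ j"
        by (simp flip: diff_divide_distrib)
      then have "(2::real) ^ j \<le> 2 ^ k"
        by (simp add: divide_simps)
      with False show False by simp
    qed
    with sub False show ?thesis by (simp add: u v depth_def)
  qed
qed

lemma anc_le_refl [simp]: "anc_le u u"
  by (simp add: anc_le_def)

lemma anc_le_trans: "anc_le v w \<Longrightarrow> anc_le w u \<Longrightarrow> anc_le v u"
  unfolding anc_le_def by (rule subset_trans)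

lemma anc_le_depth: "anc_le v u \<Longrightarrow> depth v \<le> depth u"
  by (simp add: anc_le_iff)

lemma anc_le_same_depth: "anc_le v u \<Longrightarrow> depth v = depth u \<Longrightarrow> v = u"
  by (metis anc_le_iff ancestor_at_self)

lemma anc_le_ancestor_at [simp]: "j \<le> depth u \<Longrightarrow> anc_le (ancestor_at j u) u"
  by (simp add: anc_le_iff)

lemma anc_le_chain:
  assumes "anc_le v u" "anc_le w u" "depth v \<le> depth w"
  shows "anc_le v w"
proof -
  have "ancestor_at (depth v) w = ancestor_at (depth v) (ancestor_at (depth w) u)"
    using assms(2) unfolding anc_le_iff by metis
  also have "\<dots> = ancestor_at (depth v) u"
    using assms anc_le_depth by (intro ancestor_at_ancestor_at)
  also have "\<dots> = v"
    using assms(1) by (simp add: anc_le_iff)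
  finally show ?thesis
    using assms(3) by (simp add: anc_le_iff)
qed

lemma depth_0_iff: "u \<in> vertices \<Longrightarrow> depth u = 0 \<longleftrightarrow> u = root_vertex"
  by (auto simp: vertices_def depth_def root_vertex_def vec_eq_iff)

lemma root_in_vertices [simp]: "root_vertex \<in> vertices"
  by (simp add: vertices_def root_vertex_def)

lemma depth_root [simp]: "depth root_vertex = 0"
  by (simp add: depth_def root_vertex_def)

lemma anc_le_root: "u \<in> vertices \<Longrightarrow> anc_le root_vertex u"
  by (metis anc_le_ancestor_at ancestor_at_vertices depth_0_iff depth_ancestor_at zero_le)

lemma cube_root: "cube root_vertex = unit_cube"
proof -
  have "(\<chi> i. 0) = (0 :: real ^ 'a)" "(\<chi> i. 1) = (1 :: real ^ 'a)"
    by (simp_all add: vec_eq_iff)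
  then show ?thesis
    by (simp add: cube_def root_vertex_def unit_cube_def)
qed

lemma cube_subset_unit_cube: "u \<in> vertices \<Longrightarrow> cube u \<subseteq> unit_cube"
  using anc_le_root[of u] by (simp add: anc_le_def cube_root)

lemma children_iff:
  "u \<in> children v \<longleftrightarrow> u \<in> vertices \<and> depth u = Suc (depth v) \<and> v = ancestor_at (depth v) u"
proof -
  have "depth v \<le> depth u" if "depth u = Suc (depth v)"
    using that by simp
  then show ?thesis
    unfolding children_def mem_Collect_eq anc_le_def[symmetric] anc_le_iff by blast
qed

lemma parent_eq:
  assumes "u \<in> vertices" "u \<noteq> root_vertex"
  shows "parent u = ancestor_at (depth u - 1) u"
  unfolding parent_def
proof (rule the_equality)
  have d: "depth u > 0"
    using assms depth_0_iff[of u] by auto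
  show "ancestor_at (depth u - 1) u \<in> vertices \<and> u \<in> children (ancestor_at (depth u - 1) u)"
    using assms(1) d by (simp add: children_iff ancestor_at_vertices)
qed (metis children_iff diff_Suc_1)

lemma depth_parent:
  "u \<in> vertices \<Longrightarrow> u \<noteq> root_vertex \<Longrightarrow> Suc (depth (parent u)) = depth u"
  using depth_0_iff[of u] by (simp add: parent_eq)

lemma parent_in_vertices: "u \<in> vertices \<Longrightarrow> u \<noteq> root_vertex \<Longrightarrow> parent u \<in> vertices"
  by (simp add: parent_eq ancestor_at_vertices)

lemma parent_anc_le: "u \<in> vertices \<Longrightarrow> u \<noteq> root_vertex \<Longrightarrow> anc_le (parent u) u"
  by (simp add: parent_eq)

lemma ancestors_eq:
  assumes "u \<in> vertices"
  shows "ancestors u = (\<lambda>j. ancestor_at j u) ` {1..depth u}"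
proof (intro equalityI subsetI)
  fix v assume "v \<in> ancestors u"
  then have v: "v \<in> vertices" "anc_le v u" "v \<noteq> root_vertex"
    by (auto simp: ancestors_def)
  then have "depth v \<noteq> 0" by (simp add: depth_0_iff)
  with v show "v \<in> (\<lambda>j. ancestor_at j u) ` {1..depth u}"
    by (auto simp: anc_le_iff intro!: image_eqI[of _ _ "depth v"])
next
  fix v assume "v \<in> (\<lambda>j. ancestor_at j u) ` {1..depth u}"
  then obtain j where j: "1 \<le> j" "j \<le> depth u" "v = ancestor_at j u" by auto
  then have "v \<noteq> root_vertex"
    by (metis depth_ancestor_at depth_root not_one_le_zero)
  with j assms show "v \<in> ancestors u"
    by (simp add: ancestors_def ancestor_at_vertices)
qed

lemma finite_ancestors: "u \<in> vertices \<Longrightarrow> finite (ancestors u)"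
  by (simp add: ancestors_eq)

lemma ancestors_root [simp]: "ancestors root_vertex = {}"
  by (simp add: ancestors_eq)

lemma ancestors_insert:
  assumes "u \<in> vertices" "u \<noteq> root_vertex"
  shows "ancestors u = insert u (ancestors (parent u))" "u \<notin> ancestors (parent u)"
proof -
  have p: "depth u = Suc (depth (parent u))"
    using depth_parent[OF assms] by simp
  have "v \<in> ancestors u \<longleftrightarrow> v = u \<or> v \<in> ancestors (parent u)" for v
  proof
    assume v: "v \<in> ancestors u"
    show "v = u \<or> v \<in> ancestors (parent u)"
    proof (cases "depth v = depth u")
      case True
      with v show ?thesis by (auto simp: ancestors_def dest: anc_le_same_depth)
    next
      case False
      with v p have "depth v \<le> depth (parent u)"
        using anc_le_depth[of v u] by (simp add: ancestors_def)
      with v show ?thesis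
        using anc_le_chain[OF _ parent_anc_le[OF assms]] by (auto simp: ancestors_def)
    qed
  next
    assume "v = u \<or> v \<in> ancestors (parent u)"
    with assms show "v \<in> ancestors u"
      using parent_anc_le[OF assms] by (auto simp: ancestors_def intro: anc_le_trans)
  qed
  then show "ancestors u = insert u (ancestors (parent u))" by blast
  show "u \<notin> ancestors (parent u)"
    using p anc_le_depth[of u "parent u"] by (auto simp: ancestors_def)
qed

text \<open>
  A path meets every depth once, so that the samples used along it belong to different vertices.
\<close>

lemma inj_on_parent_ancestors:
  assumes "u \<in> vertices"
  shows "inj_on parent (ancestors u)"
proof (rule inj_onI)
  fix v w assume vw: "v \<in> ancestors u" "w \<in> ancestors u" "parent v = parent w"
  then have "depth v = depth w"
    by (metis (mono_tags, lifting) ancestors_def depth_parent mem_Collect_eq)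
  with vw show "v = w"
    by (metis (mono_tags, lifting) anc_le_iff ancestors_def mem_Collect_eq)
qed

lemma common_ancestor_max:
  assumes "u \<in> vertices" "u' \<in> vertices"
  shows "common_ancestor u u' \<in> vertices" "anc_le (common_ancestor u u') u"
    "anc_le (common_ancestor u u') u'"
    "\<And>w. w \<in> vertices \<Longrightarrow> anc_le w u \<Longrightarrow> anc_le w u' \<Longrightarrow> depth w \<le> depth (common_ancestor u u')"
proof -
  let ?P = "\<lambda>w. w \<in> vertices \<and> anc_le w u \<and> anc_le w u'"
  have "?P root_vertex" using assms by (simp add: anc_le_root)
  moreover have "\<forall>w. ?P w \<longrightarrow> depth w < Suc (depth u)"
    using anc_le_depth le_imp_less_Suc by blast
  ultimately have "?P (arg_max depth ?P) \<and> (\<forall>w. ?P w \<longrightarrow> depth w \<le> depth (arg_max depth ?P))"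
    by (rule arg_max_nat_lemma)
  then show "common_ancestor u u' \<in> vertices" "anc_le (common_ancestor u u') u"
    "anc_le (common_ancestor u u') u'"
    "\<And>w. w \<in> vertices \<Longrightarrow> anc_le w u \<Longrightarrow> anc_le w u' \<Longrightarrow> depth w \<le> depth (common_ancestor u u')"
    by (auto simp: common_ancestor_def)
qed

lemma ancestors_common_ancestor:
  assumes "u \<in> vertices" "u' \<in> vertices"
  shows "ancestors (common_ancestor u u') = ancestors u \<inter> ancestors u'"
proof -
  note ca = common_ancestor_max[OF assms]
  have "anc_le v (common_ancestor u u') \<longleftrightarrow> anc_le v u \<and> anc_le v u'" if "v \<in> vertices" for v
    using ca that by (meson anc_le_chain anc_le_trans)
  then show ?thesis by (auto simp: ancestors_def)
qed

text \<open>
  Two incomparable vertices branch off at the children of their common ancestor. Above this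
  place the paths agree, and below it the parents differ because they are not common ancestors.
\<close>

lemma unique_sibling_pair:
  assumes u: "u \<in> vertices" and u': "u' \<in> vertices"
    and inc: "\<not> anc_le u u'" "\<not> anc_le u' u"
  obtains x y where
    "{(v, v') \<in> ancestors u \<times> ancestors u'. v \<noteq> v' \<and> parent v = parent v'} = {(x, y)}"
    "depth x = depth y" "anc_le x u" "anc_le y u'" "x \<noteq> y"
proof -
  define w where "w = common_ancestor u u'"
  note ca = common_ancestor_max[OF u u', folded w_def]
  define l where "l = depth w"
  have less: "l < depth u" "l < depth u'"
    using ca(2,3) inc anc_le_same_depth[of w u] anc_le_same_depth[of w u']
      anc_le_depth[of w u] anc_le_depth[of w u']
    by (auto simp: l_def order_less_le)
  define x y where "x = ancestor_at (Suc l) u" and "y = ancestor_at (Suc l) u'"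
  have xy: "x \<in> vertices" "y \<in> vertices" "anc_le x u" "anc_le y u'" "depth x = Suc l" "depth y = Suc l"
    using less u u' by (auto simp: x_def y_def ancestor_at_vertices)
  have root: "x \<noteq> root_vertex" "y \<noteq> root_vertex"
    using xy(5,6) by (metis depth_root nat.distinct(1))+
  have ne: "x \<noteq> y"
    using ca(4)[of x] xy by (auto simp: l_def)
  have par: "parent x = w" "parent y = w"
    using xy root less ca(2,3)
    by (auto simp: parent_eq x_def y_def ancestor_at_ancestor_at l_def anc_le_iff)
  have uniq: "v = x \<and> v' = y"
    if v: "v \<in> ancestors u" and v': "v' \<in> ancestors u'" and "v \<noteq> v'" "parent v = parent v'" for v v'
  proof -
    from v v' have V: "v \<in> vertices" "v \<noteq> root_vertex" "anc_le v u"
      "v' \<in> vertices" "v' \<noteq> root_vertex" "anc_le v' u'"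
      by (auto simp: ancestors_def)
    have "anc_le (parent v) u" "anc_le (parent v) u'"
      using V parent_anc_le[of v] parent_anc_le[of v'] \<open>parent v = parent v'\<close>
      by (auto intro: anc_le_trans)
    then have "depth (parent v) \<le> l"
      using ca(4) V parent_in_vertices unfolding l_def by blast
    then have dv: "depth v \<le> Suc l" "depth v' = depth v"
      using depth_parent V \<open>parent v = parent v'\<close> by (metis Suc_le_mono)+
    have "depth v = Suc l"
    proof (rule ccontr)
      assume "depth v \<noteq> Suc l"
      then have "depth v \<le> l" using dv by simp
      then have "anc_le v w" "anc_le v' w"
        using anc_le_chain[OF V(3) ca(2)] anc_le_chain[OF V(6) ca(3)] dv by (auto simp: l_def)
      then show False
        using dv \<open>v \<noteq> v'\<close> by (metis anc_le_iff)
    qed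
    then show ?thesis using V dv by (simp add: x_def y_def anc_le_iff)
  qed
  have mem: "x \<in> ancestors u" "y \<in> ancestors u'"
    using xy root by (auto simp: ancestors_def)
  have "{(v, v') \<in> ancestors u \<times> ancestors u'. v \<noteq> v' \<and> parent v = parent v'} = {(x, y)}"
    (is "?A = _")
  proof (intro equalityI subsetI)
    fix z assume "z \<in> ?A"
    then show "z \<in> {(x, y)}" using uniq by blast
  next
    fix z assume "z \<in> {(x, y)}"
    then show "z \<in> ?A" using ne mem par by simp
  qed
  then show thesis using that[of x y] xy ne by simp
qed

lemma finite_vertices_depth_le: "finite {v :: 'd::finite vertex. v \<in> vertices \<and> depth v \<le> k}"
proof -
  have "finite {m :: nat ^ 'd. \<forall>i. m $ i < 2 ^ k}"
  proof (rule finite_imageD)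
    show "finite (vec_nth ` {m :: nat ^ 'd. \<forall>i. m $ i < 2 ^ k})"
      by (rule finite_subset[OF _ finite_PiE[of UNIV "\<lambda>_. {..<2 ^ k}"]]) auto
  qed (simp add: inj_on_def vec_nth_inject)
  then have "finite ({..k} \<times> {m :: nat ^ 'd. \<forall>i. m $ i < 2 ^ k})" by simp
  then show ?thesis
    by (rule rev_finite_subset)
      (auto simp: vertices_def depth_def intro: less_le_trans power_increasing)
qed

lemma cube_containing:
  fixes x :: "real ^ 'd::finite"
  assumes "x \<in> unit_cube"
  obtains v where "v \<in> vertices" "depth v = k" "x \<in> cube v"
proof -
  (* The minimum treats the coordinates equal to 1, which belong to the last interval. *)
  define m :: "nat ^ 'd" where "m = (\<chi> i. min (nat \<lfloor>x $ i * 2 ^ k\<rfloor>) (2 ^ k - 1))"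
  have x: "0 \<le> x $ i" "x $ i \<le> 1" for i
    using assms by (auto simp: unit_cube_def mem_box_cart)
  have "real (m $ i) \<le> x $ i * 2 ^ k \<and> x $ i * 2 ^ k \<le> real (m $ i) + 1" for i
  proof (cases "nat \<lfloor>x $ i * 2 ^ k\<rfloor> \<le> 2 ^ k - 1")
    case True
    then have "m $ i = nat \<lfloor>x $ i * 2 ^ k\<rfloor>" by (simp add: m_def)
    then have "real (m $ i) = of_int \<lfloor>x $ i * 2 ^ k\<rfloor>" using x[of i] by simp
    then show ?thesis by linarith
  next
    case False
    then have m: "m $ i = 2 ^ k - 1" by (simp add: m_def)
    have "real (2 ^ k - 1) = 2 ^ k - 1" by (simp add: of_nat_diff)
    moreover have "(2::nat) ^ k \<le> nat \<lfloor>x $ i * 2 ^ k\<rfloor>" using False by linarith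
    then have "real (2 ^ k) \<le> of_int \<lfloor>x $ i * 2 ^ k\<rfloor>"
      using x[of i] by (metis of_nat_mono of_nat_nat zero_le_floor mult_nonneg_nonneg
          zero_le_numeral zero_le_power)
    then have "2 ^ k \<le> x $ i * 2 ^ k" 
      using order_trans[OF _ of_int_floor_le[of "x $ i * 2 ^ k"]] by simp
    moreover have "x $ i * 2 ^ k \<le> 1 * 2 ^ k" using x[of i] by (intro mult_right_mono) auto
    ultimately show ?thesis using m by simp
  qed
  then have "x \<in> cube (k, m)"
    by (simp add: cube_def mem_box_cart field_simps)
  moreover have "(k, m) \<in> vertices"
    by (auto simp: vertices_def m_def min_less_iff_disj)
  ultimately show thesis using that by (simp add: depth_def)
qed

lemma centre_in_cube: "centre v \<in> cube v"
  by (cases v) (simp add: centre_def cube_def mem_box_cart divide_right_mono)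

lemma infnorm_centre_le:
  assumes "x \<in> cube v"
  shows "infnorm (x - centre v) \<le> 1 / 2 ^ (depth v + 1)"
proof -
  obtain j m where v: "v = (j, m)" by fastforce
  have "\<bar>(x - centre v) $ i\<bar> \<le> 1 / 2 ^ (j + 1)" for i
  proof -
    define P :: real where "P = 1 / 2 ^ j"
    have "real (m $ i) * P \<le> x $ i" "x $ i \<le> real (m $ i) * P + P"
      using assms by (auto simp: v cube_def mem_box_cart P_def add_divide_distrib)
    moreover have "centre v $ i = real (m $ i) * P + P / 2"
      by (simp add: v centre_def P_def add_divide_distrib)
    ultimately have "\<bar>(x - centre v) $ i\<bar> \<le> P / 2"
      unfolding vector_minus_component by linarith
    then show ?thesis by (simp add: P_def)
  qed
  then show ?thesis
    unfolding infnorm_cart by (intro cSup_least) (auto simp: v depth_def)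
qed

text \<open>
  In a coordinate where the corners differ, the two intervals meet in at most one point, so the
  intersection of the cubes lies in a hyperplane.
\<close>

lemma cubes_same_depth_overlap:
  fixes v w :: "'d::finite vertex"
  assumes "depth v = depth w" "v \<noteq> w"
  shows "cube v \<inter> cube w \<in> null_sets lborel"
proof -
  obtain j a b where v: "v = (j, a)" and w: "w = (j, b)"
    using assms(1) by (metis depth_def prod.collapse)
  obtain i where i: "a $ i \<noteq> b $ i"
    using assms(2) v w by (auto simp: vec_eq_iff)
  define c where "c = max (real (a $ i)) (real (b $ i)) / 2 ^ j"
  have "x $ i = c" if "x \<in> cube v \<inter> cube w" for x
  proof -
    have "real (a $ i) \<le> x $ i * 2 ^ j" "x $ i * 2 ^ j \<le> real (a $ i) + 1"
      "real (b $ i) \<le> x $ i * 2 ^ j" "x $ i * 2 ^ j \<le> real (b $ i) + 1"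
      using that by (auto simp: v w cube_def mem_box_cart field_simps)
    moreover have "real (a $ i) + 1 \<le> real (b $ i) \<or> real (b $ i) + 1 \<le> real (a $ i)"
      using i by linarith
    ultimately have "x $ i * 2 ^ j = max (real (a $ i)) (real (b $ i))" by linarith
    then show ?thesis by (simp add: c_def field_simps)
  qed
  then have "cube v \<inter> cube w \<subseteq> {x. x \<bullet> axis i 1 = c}"
    by (auto simp: inner_axis)
  moreover have "negligible {x :: real ^ 'd. x \<bullet> axis i 1 = c}"
    by (rule negligible_standard_hyperplane) (simp add: axis_in_Basis_iff)
  ultimately have "negligible (cube v \<inter> cube w)"
    by (rule negligible_subset[rotated])
  moreover have "cube v \<inter> cube w \<in> sets lborel"
    by (auto simp: v w cube_def)
  ultimately show ?thesis
    by (simp add: negligible_iff_null_sets null_sets_completion_iff)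
qed

lemma cube_borel [measurable]: "cube v \<in> sets borel"
  by (cases v) (simp add: cube_def)

section \<open>The recursive search\<close>

text \<open>
  The vertices that the recursion reaches when it is run without a bound on the depth. Trees,
  leaves and newly created vertices are described through them without recursion.
\<close>

definition active :: "(real ^ 'd::finite \<Rightarrow> real) \<Rightarrow> real \<Rightarrow> real \<Rightarrow> 'd vertex \<Rightarrow> bool" where
  "active g T L v \<longleftrightarrow> (\<forall>j<depth v. label_of g T L (ancestor_at j v) = Undecided)"

text \<open>
  This is what makes the selected cubes an antichain: a decided vertex has no active descendants.
\<close>

lemma active_ancestor:
  assumes "active g T L u" "anc_le v u" "v \<noteq> u"
  shows "label_of g T L v = Undecided"
proof -
  have v: "depth v \<le> depth u" "ancestor_at (depth v) u = v"
    using assms(2) by (simp_all add: anc_le_iff)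
  moreover have "depth v \<noteq> depth u"
    using assms(2,3) anc_le_same_depth by blast
  ultimately have "depth v < depth u" by simp
  with assms(1) v show ?thesis unfolding active_def by metis
qed

lemma active_child:
  assumes "u \<in> children v"
  shows "active g T L u \<longleftrightarrow> active g T L v \<and> label_of g T L v = Undecided"
proof -
  have u: "depth u = Suc (depth v)" "ancestor_at (depth v) u = v"
    using assms by (auto simp: children_iff)
  have "ancestor_at j u = ancestor_at j v" if "j < depth v" for j
    using ancestor_at_ancestor_at[of j "depth v" u] that u by simp
  then show ?thesis
    using u by (auto simp: active_def less_Suc_eq)
qed

lemma children_nonempty:
  fixes v :: "'d::finite vertex"
  assumes "v \<in> vertices"
  shows "children v \<noteq> {}"
proof -
  define u :: "'d vertex" where "u = (Suc (depth v), \<chi> i. 2 * snd v $ i)"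
  have u: "depth u = Suc (depth v)" by (simp add: u_def depth_def)
  have "ancestor_at (depth v) u = v"
    by (simp add: ancestor_at_def u) (simp add: u_def depth_def vec_eq_iff prod_eq_iff)
  moreover have "u \<in> vertices"
    using assms by (auto simp: u_def vertices_def depth_def)
  ultimately have "u \<in> children v" using u by (simp add: children_iff)
  then show ?thesis by blast
qed

text \<open>
  All children of an active undecided vertex are active, no child of a decided vertex is, and
  every vertex has children.
\<close>

lemma leaves_active_upto:
  fixes A :: "'d::finite vertex set"
  assumes A: "A = {v \<in> vertices. depth v \<le> k \<and> active g T L v}"
  shows "leaves A = {v \<in> vertices. active g T L v \<and>
      (depth v = k \<or> depth v < k \<and> label_of g T L v \<noteq> Undecided)}"
proof -
  have "children v \<inter> A = {} \<longleftrightarrow> depth v = k \<or> label_of g T L v \<noteq> Undecided"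
    if v: "v \<in> vertices" "depth v \<le> k" "active g T L v" for v
  proof -
    have "u \<in> A \<longleftrightarrow> depth v < k \<and> label_of g T L v = Undecided" if "u \<in> children v" for u
    proof -
      have "u \<in> vertices" "depth u = Suc (depth v)"
        using that by (auto simp: children_iff)
      then show ?thesis
        using v(3) active_child[OF that, of g T L] by (auto simp: A)
    qed
    then have "children v \<inter> A = {} \<longleftrightarrow> \<not> (depth v < k \<and> label_of g T L v = Undecided)"
      using children_nonempty[OF v(1)] by blast
    with v(2) show ?thesis by auto
  qed
  then show ?thesis
    unfolding leaves_def A mem_Collect_eq using le_eq_less_or_eq by blast
qed

lemma tree_eq: "tree g T L k = {v \<in> vertices. depth v \<le> k \<and> active g T L v}"
proof (induction k)
  case 0
  show ?case by (auto simp: active_def depth_0_iff)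
next
  case (Suc k)
  note leaves = leaves_active_upto[OF Suc]
  have "(\<Union>v \<in> {v \<in> leaves (tree g T L k). label_of g T L v = Undecided}. children v)
      = {u \<in> vertices. depth u = Suc k \<and> active g T L u}" (is "?A = ?B")
  proof (intro equalityI subsetI)
    fix u assume "u \<in> ?A"
    then obtain v where v: "v \<in> leaves (tree g T L k)" "label_of g T L v = Undecided"
      "u \<in> children v" by blast
    moreover have "u \<in> vertices" "depth u = Suc (depth v)"
      using v(3) by (auto simp: children_iff)
    ultimately show "u \<in> ?B"
      using active_child[OF v(3), of g T L] leaves by simp
  next
    fix u assume u: "u \<in> ?B"
    define v where "v = ancestor_at k u"
    have v: "v \<in> vertices" "u \<in> children v" "depth v = k"
      using u by (auto simp: v_def ancestor_at_vertices children_iff)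
    with u show "u \<in> ?A"
      using active_child[OF v(2), of g T L] leaves by blast
  qed
  then show ?case using Suc by (auto simp: le_Suc_eq)
qed

lemmas leaves_tree_eq = leaves_active_upto[OF tree_eq]

text \<open>
  A cube of depth \<open>j\<close> is the ball of radius \<open>1 / 2 ^ (j + 1)\<close> around its centre for the supremum
  norm, so the Lipschitz condition makes the labels valid on whole cubes.
\<close>

locale threshold_search =
  fixes g :: "real ^ 'd::finite \<Rightarrow> real" and T L :: real
    and enum :: "nat \<Rightarrow> 'd vertex list" and n :: nat
  assumes lipschitz: "x \<in> unit_cube \<Longrightarrow> y \<in> unit_cube \<Longrightarrow> \<bar>g x - g y\<bar> \<le> L * infnorm (x - y)"
    and enum: "set (enum j) = new_vertices g T L j"
begin

abbreviation "lab \<equiv> label_of g T L"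

lemma L_nonneg: "0 \<le> L"
proof -
  have "0 \<le> L * infnorm (0 - 1 :: real ^ 'd)"
    using lipschitz[of 0 1] by (simp add: unit_cube_def mem_box_cart)
  moreover have "infnorm (0 - 1 :: real ^ 'd) > 0"
    by (simp add: infnorm_pos_lt)
  ultimately show ?thesis by (simp add: zero_le_mult_iff)
qed

lemma deviation_from_centre:
  assumes "v \<in> vertices" "x \<in> cube v"
  shows "\<bar>g x - g (centre v)\<bar> \<le> L / 2 ^ (depth v + 1)"
proof -
  have "\<bar>g x - g (centre v)\<bar> \<le> L * infnorm (x - centre v)"
    using assms cube_subset_unit_cube centre_in_cube by (intro lipschitz) blast+
  also have "\<dots> \<le> L * (1 / 2 ^ (depth v + 1))"
    using infnorm_centre_le[OF assms(2)] L_nonneg by (rule mult_left_mono)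
  finally show ?thesis by simp
qed

lemma label_Inside: "v \<in> vertices \<Longrightarrow> lab v = Inside \<Longrightarrow> x \<in> cube v \<Longrightarrow> T < g x"
  using deviation_from_centre[of v x] by (auto simp: label_of_def split: if_splits)

lemma label_Outside: "v \<in> vertices \<Longrightarrow> lab v = Outside \<Longrightarrow> x \<in> cube v \<Longrightarrow> g x < T"
  using deviation_from_centre[of v x] by (auto simp: label_of_def split: if_splits)

abbreviation "level \<equiv> budget_level g T L n"

lemma evaluated_subset:
  "evaluated g T L enum n \<subseteq> {v \<in> vertices. depth v = Suc level \<and> active g T L v}"
proof -
  have "evaluated g T L enum n \<subseteq> set (enum (Suc level))"
    by (simp add: evaluated_def Let_def set_take_subset)
  then show ?thesis
    unfolding enum new_vertices_def tree_eq by blast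
qed

lemma undecided_children:
  "(\<Union>v \<in> labelled_leaves g T L Undecided k. children v) =
     {u \<in> vertices. depth u = Suc k \<and> active g T L u}" (is "?A = ?B")
proof (intro equalityI subsetI)
  fix u assume "u \<in> ?A"
  then obtain v where v: "v \<in> labelled_leaves g T L Undecided k" "u \<in> children v" by blast
  then have "depth v = k" "active g T L v" "lab v = Undecided"
    by (auto simp: labelled_leaves_def leaves_tree_eq)
  moreover have "u \<in> vertices" "depth u = Suc (depth v)"
    using v(2) by (auto simp: children_iff)
  ultimately show "u \<in> ?B"
    using active_child[OF v(2), of g T L] by simp
next
  fix u assume u: "u \<in> ?B"
  define v where "v = ancestor_at k u"
  have v: "v \<in> vertices" "u \<in> children v" "depth v = k"
    using u by (auto simp: v_def ancestor_at_vertices children_iff)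
  with u have "v \<in> labelled_leaves g T L Undecided k"
    using active_child[OF v(2), of g T L]
    by (simp add: labelled_leaves_def leaves_tree_eq)
  with v show "u \<in> ?A" by blast
qed

abbreviation "Ins \<equiv> inside_cubes g T L enum n"
abbreviation "Und \<equiv> undecided_cubes g T L enum n"

lemma insideD:
  assumes "v \<in> Ins"
  shows "v \<in> vertices" "active g T L v" "lab v = Inside" "depth v \<le> Suc level"
    "depth v = Suc level \<Longrightarrow> v \<in> evaluated g T L enum n"
  using assms evaluated_subset
  by (auto simp: inside_cubes_def labelled_leaves_def leaves_tree_eq)

lemma undecidedD:
  assumes "v \<in> Und"
  shows "v \<in> vertices" "active g T L v" "depth v = Suc level"
    "v \<in> evaluated g T L enum n \<Longrightarrow> lab v = Undecided"
  using assms evaluated_subset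
  unfolding undecided_cubes_def undecided_children by auto

lemma inside_undecided_vertices: "Ins \<union> Und \<subseteq> vertices"
  using insideD(1) undecidedD(1) by blast

lemma finite_inside_undecided: "finite (Ins \<union> Und)"
  by (rule finite_subset[OF _ finite_vertices_depth_le[of "Suc level"]])
    (use insideD undecidedD in fastforce)

lemma inside_undecided_disjoint: "Ins \<inter> Und = {}"
  using insideD undecidedD by (metis disjoint_iff label.distinct(3))

text \<open>
  A vertex strictly above an active one is labelled undecided. The selected vertices with this
  label lie at the greatest depth, where no selected vertex is below them.
\<close>

lemma inside_undecided_antichain:
  assumes "u \<in> Ins \<union> Und" "v \<in> Ins \<union> Und" "anc_le v u"
  shows "v = u"
proof (rule ccontr)
  assume ne: "v \<noteq> u"
  have "active g T L u" and d: "depth u \<le> Suc level"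
    using assms(1) insideD[of u] undecidedD[of u] by auto
  then have "lab v = Undecided"
    using active_ancestor assms(3) ne by blast
  then have "depth v = Suc level"
    using assms(2) insideD(3)[of v] undecidedD(3)[of v] by auto
  then have "depth v = depth u"
    using d anc_le_depth[OF assms(3)] by simp
  with ne assms(3) show False
    using anc_le_same_depth by blast
qed

lemma inside_above: "v \<in> Ins \<Longrightarrow> x \<in> cube v \<Longrightarrow> T < g x"
  using insideD label_Inside by blast

lemma above_covered:
  assumes "x \<in> unit_cube" "T < g x"
  shows "\<exists>v \<in> Ins \<union> Und. x \<in> cube v"
proof -
  obtain v where v: "v \<in> vertices" "depth v = Suc level" "x \<in> cube v"
    using cube_containing[OF assms(1)] .
  have anc: "ancestor_at j v \<in> vertices" "x \<in> cube (ancestor_at j v)"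
    "lab (ancestor_at j v) \<noteq> Outside" if "j \<le> Suc level" for j
  proof -
    show *: "ancestor_at j v \<in> vertices" "x \<in> cube (ancestor_at j v)"
      using v that ancestor_at_vertices[of v j] anc_le_ancestor_at[of j v]
      by (auto simp: anc_le_def)
    show "lab (ancestor_at j v) \<noteq> Outside"
      using label_Outside[OF *(1) _ *(2)] assms(2) by force
  qed
  show ?thesis
  proof (cases "active g T L v")
    case True
    have "v \<in> Ins \<union> Und"
    proof (cases "v \<in> evaluated g T L enum n")
      case True
      then have "lab v \<noteq> Outside"
        using anc(3)[of "Suc level"] v by (metis ancestor_at_self order_refl)
      with True show ?thesis
        by (cases "lab v") (auto simp: inside_cubes_def undecided_cubes_def)
    next
      case False
      with v True show ?thesis
        unfolding undecided_cubes_def undecided_children by blast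
    qed
    with v show ?thesis by blast
  next
    case False
    (* The first decided cube on the path to x is a leaf, and it cannot be outside. *)
    define j where "j = (LEAST j. lab (ancestor_at j v) \<noteq> Undecided)"
    obtain i where i: "i < Suc level" "lab (ancestor_at i v) \<noteq> Undecided"
      using False v by (auto simp: active_def)
    have j: "lab (ancestor_at j v) \<noteq> Undecided" "j \<le> i"
      unfolding j_def
      using LeastI[of "\<lambda>j. lab (ancestor_at j v) \<noteq> Undecided", OF i(2)]
        Least_le[of "\<lambda>j. lab (ancestor_at j v) \<noteq> Undecided", OF i(2)] by auto
    have before: "lab (ancestor_at l v) = Undecided" if "l < j" for l
      using not_less_Least[of l] that unfolding j_def by blast
    define w where "w = ancestor_at j v"
    have "j \<le> level" using i j by simp
    then have w: "w \<in> vertices" "x \<in> cube w" "lab w = Inside" "depth w \<le> level"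
      using anc[of j] j label.exhaust by (auto simp: w_def)
    have "ancestor_at l w = ancestor_at l v" if "l < j" for l
      unfolding w_def using that \<open>j \<le> level\<close> v by (intro ancestor_at_ancestor_at) auto
    then have "active g T L w"
      using before by (simp add: active_def w_def)
    with w have "w \<in> Ins"
      by (auto simp: inside_cubes_def labelled_leaves_def leaves_tree_eq)
    with w show ?thesis by blast
  qed
qed

end

section \<open>Linearisation of a product\<close>

lemma abs_prod_diff_le:
  fixes x y :: "'b \<Rightarrow> real"
  assumes "finite A" and x: "\<And>v. v \<in> A \<Longrightarrow> 0 \<le> x v \<and> x v \<le> 1" and y: "\<And>v. v \<in> A \<Longrightarrow> 0 \<le> y v \<and> y v \<le> 1"
  shows "\<bar>(\<Prod>v\<in>A. x v) - (\<Prod>v\<in>A. y v)\<bar> \<le> (\<Sum>v\<in>A. \<bar>x v - y v\<bar>)"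
  using norm_prod_diff[of A x y] x y by auto

text \<open>
  The second order Taylor estimate for a product of numbers in the unit interval. Adding a factor
  to the product adds to the error the first order error of that factor times the error of the
  old product, which is a mixed term of the square.
\<close>

lemma prod_linearization_error:
  fixes x y :: "'b \<Rightarrow> real"
  assumes "finite A" and "\<And>v. v \<in> A \<Longrightarrow> 0 \<le> x v \<and> x v \<le> 1" and "\<And>v. v \<in> A \<Longrightarrow> 0 \<le> y v \<and> y v \<le> 1"
  shows "\<bar>(\<Prod>v\<in>A. x v) - (\<Prod>v\<in>A. y v) - (\<Sum>v\<in>A. (x v - y v) * (\<Prod>w\<in>A-{v}. y w))\<bar>
           \<le> (\<Sum>v\<in>A. \<bar>x v - y v\<bar>)\<^sup>2"
  using assms
proof (induction A rule: finite_induct)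
  case empty
  then show ?case by simp
next
  case (insert a A)
  let ?X = "\<Prod>v\<in>A. x v" and ?Y = "\<Prod>v\<in>A. y v"
  let ?lin = "\<Sum>v\<in>A. (x v - y v) * (\<Prod>w\<in>A-{v}. y w)"
  let ?d = "\<Sum>v\<in>A. \<bar>x v - y v\<bar>"
  have "(\<Prod>w\<in>insert a A - {v}. y w) = y a * (\<Prod>w\<in>A-{v}. y w)" if "v \<in> A" for v
  proof -
    have "insert a A - {v} = insert a (A - {v})" using that insert.hyps by auto
    then show ?thesis using insert.hyps by simp
  qed
  then have "(\<Sum>v\<in>A. (x v - y v) * (\<Prod>w\<in>insert a A - {v}. y w)) = y a * ?lin"
    by (simp add: sum_distrib_left algebra_simps)
  moreover have "insert a A - {a} = A" using insert.hyps by auto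
  ultimately have lin: "(\<Sum>v\<in>insert a A. (x v - y v) * (\<Prod>w\<in>insert a A-{v}. y w))
      = (x a - y a) * ?Y + y a * ?lin"
    using insert.hyps by simp
  have "(\<Prod>v\<in>insert a A. x v) - (\<Prod>v\<in>insert a A. y v)
      - (\<Sum>v\<in>insert a A. (x v - y v) * (\<Prod>w\<in>insert a A-{v}. y w))
      = y a * (?X - ?Y - ?lin) + (x a - y a) * (?X - ?Y)"
    unfolding lin using insert.hyps by (simp add: algebra_simps)
  also have "\<bar>\<dots>\<bar> \<le> \<bar>y a\<bar> * \<bar>?X - ?Y - ?lin\<bar> + \<bar>x a - y a\<bar> * \<bar>?X - ?Y\<bar>"
    by (simp add: abs_mult abs_triangle_ineq[THEN order_trans])
  also have "\<dots> \<le> 1 * ?d\<^sup>2 + \<bar>x a - y a\<bar> * ?d"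
    using insert by (intro add_mono mult_mono abs_prod_diff_le) auto
  also have "\<dots> \<le> (\<bar>x a - y a\<bar> + ?d)\<^sup>2"
    using sum_nonneg[of A "\<lambda>v. \<bar>x v - y v\<bar>"] by (simp add: power2_sum)
  finally show ?case using insert.hyps by simp
qed

section \<open>Limit theorems for bounded variables\<close>

lemma cmod_iexp_diff_le: "cmod (iexp x - iexp y) \<le> \<bar>x - y\<bar>"
proof -
  have "iexp x - iexp y = iexp y * (iexp (x - y) - 1)"
    by (simp add: algebra_simps flip: exp_add)
  then have "cmod (iexp x - iexp y) = cmod (iexp (x - y) - 1)"
    by (simp add: norm_mult)
  also have "\<dots> \<le> \<bar>x - y\<bar>"
    using iexp_approx1[of "x - y" 0] by simp
  finally show ?thesis .
qed

context prob_space
begin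

lemma char_distr_eq:
  "random_variable borel A \<Longrightarrow> char (distr M borel A) t = expectation (\<lambda>\<omega>. iexp (t * A \<omega>))"
  unfolding char_def by (subst integral_distr) auto

text \<open>
  A form of Slutsky's theorem. A perturbation that is small in mean moves the characteristic
  function at \<open>t\<close> by at most \<open>\<bar>t\<bar>\<close> times its mean absolute value, so that Levy's continuity
  theorem applies.
\<close>

lemma weak_conv_perturb:
  fixes A B :: "nat \<Rightarrow> 'a \<Rightarrow> real"
  assumes [measurable]: "\<And>N. random_variable borel (A N)" "\<And>N. random_variable borel (B N)"
    and "\<And>N. integrable M (\<lambda>\<omega>. A N \<omega> - B N \<omega>)"
    and L1: "(\<lambda>N. expectation (\<lambda>\<omega>. \<bar>A N \<omega> - B N \<omega>\<bar>)) \<longlonglongrightarrow> 0"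
    and \<mu>: "real_distribution \<mu>"
    and B: "\<And>t. (\<lambda>N. char (distr M borel (B N)) t) \<longlonglongrightarrow> char \<mu> t"
  shows "weak_conv_m (\<lambda>N. distr M borel (A N)) \<mu>"
proof (rule levy_continuity)
  fix t
  have bound: "cmod (char (distr M borel (A N)) t - char (distr M borel (B N)) t)
      \<le> \<bar>t\<bar> * expectation (\<lambda>\<omega>. \<bar>A N \<omega> - B N \<omega>\<bar>)" for N
  proof -
    have int: "integrable M (\<lambda>\<omega>. iexp (t * A N \<omega>))" "integrable M (\<lambda>\<omega>. iexp (t * B N \<omega>))"
      by (auto intro!: integrable_iexp)
    have "char (distr M borel (A N)) t - char (distr M borel (B N)) t
        = expectation (\<lambda>\<omega>. iexp (t * A N \<omega>) - iexp (t * B N \<omega>))"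
      using int by (simp add: char_distr_eq)
    also have "cmod \<dots> \<le> expectation (\<lambda>\<omega>. cmod (iexp (t * A N \<omega>) - iexp (t * B N \<omega>)))"
      by (rule integral_norm_bound)
    also have "\<dots> \<le> expectation (\<lambda>\<omega>. \<bar>t\<bar> * \<bar>A N \<omega> - B N \<omega>\<bar>)"
    proof (rule integral_mono)
      show "cmod (iexp (t * A N \<omega>) - iexp (t * B N \<omega>)) \<le> \<bar>t\<bar> * \<bar>A N \<omega> - B N \<omega>\<bar>" for \<omega>
        using cmod_iexp_diff_le[of "t * A N \<omega>" "t * B N \<omega>"]
        by (simp add: right_diff_distrib[symmetric] abs_mult)
    qed (use int assms(3)[of N] in auto)
    finally show ?thesis by simp
  qed
  have bound_lim: "(\<lambda>N. \<bar>t\<bar> * expectation (\<lambda>\<omega>. \<bar>A N \<omega> - B N \<omega>\<bar>)) \<longlonglongrightarrow> 0"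
    using tendsto_mult_left[OF L1, of "\<bar>t\<bar>"] by simp
  have "(\<lambda>N. char (distr M borel (A N)) t - char (distr M borel (B N)) t) \<longlonglongrightarrow> 0"
    by (rule Lim_null_comparison[OF _ bound_lim], rule always_eventually, rule allI, rule bound)
  then show "(\<lambda>N. char (distr M borel (A N)) t) \<longlonglongrightarrow> char \<mu> t"
    using tendsto_add[OF _ B[of t]] by fastforce
qed (auto intro!: real_distribution_distr \<mu>)

lemma indep_vars_expectation_mult:
  fixes X :: "'i \<Rightarrow> 'a \<Rightarrow> real"
  assumes "indep_vars (\<lambda>_. borel) X I" "i \<in> I" "j \<in> I" "i \<noteq> j" "\<And>i. i \<in> I \<Longrightarrow> integrable M (X i)"
  shows "expectation (\<lambda>\<omega>. X i \<omega> * X j \<omega>) = expectation (X i) * expectation (X j)"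
proof -
  have "indep_vars (\<lambda>_. borel) X {i, j}"
    using assms by (intro indep_vars_subset[OF assms(1)]) auto
  then show ?thesis
    using indep_vars_lebesgue_integral[of "{i, j}" X] assms(2-5) by fastforce
qed

lemma second_moment_indep_sum:
  fixes X :: "nat \<Rightarrow> 'a \<Rightarrow> real"
  assumes indep: "indep_vars (\<lambda>_. borel) X UNIV"
    and bounded: "\<And>i \<omega>. \<omega> \<in> space M \<Longrightarrow> \<bar>X i \<omega>\<bar> \<le> C"
    and mean: "\<And>i. expectation (X i) = 0"
    and var: "\<And>i. expectation (\<lambda>\<omega>. (X i \<omega>)\<^sup>2) = s"
  shows "expectation (\<lambda>\<omega>. (\<Sum>i<N. X i \<omega>)\<^sup>2) = real N * s"
proof -
  have [measurable]: "random_variable borel (X i)" for i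
    using indep by (simp add: indep_vars_def)
  have int1: "integrable M (X i)" for i
    by (rule integrable_const_bound[where B = C]) (auto intro!: AE_I2 bounded)
  have int: "integrable M (\<lambda>\<omega>. X i \<omega> * X j \<omega>)" for i j
  proof (rule integrable_const_bound[where B = "C * C"])
    show "AE \<omega> in M. norm (X i \<omega> * X j \<omega>) \<le> C * C"
      using bounded by (intro AE_I2) (auto simp: abs_mult intro!: mult_mono intro: order_trans[OF abs_ge_zero])
  qed auto
  have "expectation (\<lambda>\<omega>. X i \<omega> * X j \<omega>) = (if i = j then s else 0)" for i j
    using indep_vars_expectation_mult[OF indep, of i j] int1 mean var[of i]
    by (auto simp: power2_eq_square)
  then have "expectation (\<lambda>\<omega>. \<Sum>i<N. \<Sum>j<N. X i \<omega> * X j \<omega>) = (\<Sum>i<N. \<Sum>j<N. if i = j then s else 0)"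
    using int by (simp add: Bochner_Integration.integral_sum)
  then show ?thesis
    by (simp add: power2_eq_square sum_product)
qed

text \<open>
  The statement in terms of characteristic functions includes the degenerate case \<open>\<sigma> = 0\<close>, where
  all variables vanish almost surely.
\<close>

lemma clt_char:
  fixes X :: "nat \<Rightarrow> 'a \<Rightarrow> real"
  assumes indep: "indep_vars (\<lambda>_. borel) X UNIV"
    and bounded: "\<And>i \<omega>. \<omega> \<in> space M \<Longrightarrow> \<bar>X i \<omega>\<bar> \<le> C"
    and mean: "\<And>i. expectation (X i) = 0"
    and var: "\<And>i. expectation (\<lambda>\<omega>. (X i \<omega>)\<^sup>2) = \<sigma>\<^sup>2"
    and law: "\<And>i. distr M borel (X i) = \<mu>"
    and "\<sigma> \<ge> 0"
  shows "(\<lambda>N. char (distr M borel (\<lambda>\<omega>. (\<Sum>i<N. X i \<omega>) / sqrt (real N))) t) \<longlonglongrightarrow> exp (- (\<sigma> * t)\<^sup>2 / 2)"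
proof -
  have rv [measurable]: "random_variable borel (X i)" for i
    using indep by (simp add: indep_vars_def)
  have sq_bound: "(X i \<omega>)\<^sup>2 \<le> C * C" if "\<omega> \<in> space M" for i \<omega>
    using mult_mono[OF bounded bounded, OF that that, of i i] order_trans[OF abs_ge_zero bounded[OF that]]
    by (simp add: power2_eq_square flip: abs_mult)
  have int2: "integrable M (\<lambda>\<omega>. (X i \<omega>)\<^sup>2)" for i
    by (rule integrable_const_bound[where B = "C * C"]) (auto intro!: AE_I2 sq_bound)
  show ?thesis
  proof (cases "\<sigma> = 0")
    case True
    have "AE \<omega> in M. X i \<omega> = 0" for i
      using integral_nonneg_eq_0_iff_AE[OF int2[of i]] var[of i] True by simp
    then have "AE \<omega> in M. \<forall>i. X i \<omega> = 0"
      by (simp add: AE_all_countable)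
    then have "expectation (\<lambda>\<omega>. iexp (t * ((\<Sum>i<N. X i \<omega>) / sqrt (real N)))) = expectation (\<lambda>\<omega>. 1)" for N
      by (intro integral_cong_AE) auto
    then show ?thesis
      using True by (simp add: char_distr_eq prob_space)
  next
    case False
    then have pos: "\<sigma> > 0" using \<open>\<sigma> \<ge> 0\<close> by simp
    define Z where "Z N \<omega> = (\<Sum>i<N. X i \<omega>) / sqrt (real N * \<sigma>\<^sup>2)" for N \<omega>
    have [measurable]: "random_variable borel (Z N)" for N
      unfolding Z_def by measurable
    have "weak_conv_m (\<lambda>N. distr M borel (Z N)) std_normal_distribution"
      unfolding Z_def using pos mean var int2 law indep
      by (intro central_limit_theorem_zero_mean[where \<mu> = \<mu>]) auto
    then have "(\<lambda>N. char (distr M borel (Z N)) (\<sigma> * t)) \<longlonglongrightarrow> char std_normal_distribution (\<sigma> * t)"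
      by (intro levy_continuity1) (auto intro: real_dist_normal_dist)
    moreover have "char (distr M borel (Z N)) (\<sigma> * t)
        = char (distr M borel (\<lambda>\<omega>. (\<Sum>i<N. X i \<omega>) / sqrt (real N))) t" for N
    proof -
      have "\<sigma> * t * Z N \<omega> = t * ((\<Sum>i<N. X i \<omega>) / sqrt (real N))" for \<omega>
        using pos by (simp add: Z_def real_sqrt_mult)
      then show ?thesis by (simp add: char_distr_eq)
    qed
    ultimately show ?thesis
      by (simp add: char_std_normal_distribution)
  qed
qed

text \<open>
  Hoeffding's inequality bounds the probability of a deviation by \<open>\<epsilon>\<close> by a geometric sequence in
  the number of summands, so almost surely only finitely many deviations occur, by Borel and
  Cantelli.
\<close>

lemma slln_bounded:
  fixes X :: "nat \<Rightarrow> 'a \<Rightarrow> real"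
  assumes indep: "indep_vars (\<lambda>_. borel) X UNIV"
    and bounded: "\<And>i \<omega>. \<omega> \<in> space M \<Longrightarrow> 0 \<le> X i \<omega> \<and> X i \<omega> \<le> 1"
    and mean: "\<And>i. expectation (X i) = \<mu>"
  shows "AE \<omega> in M. (\<lambda>N. (\<Sum>i<N. X i \<omega>) / real N) \<longlonglongrightarrow> \<mu>"
proof -
  have rv [measurable]: "random_variable borel (X i)" for i
    using indep by (simp add: indep_vars_def)
  let ?S = "\<lambda>N \<omega>. \<Sum>i<N. X i \<omega>"
  have close: "AE \<omega> in M. eventually (\<lambda>N. \<bar>?S N \<omega> / real N - \<mu>\<bar> < \<epsilon>) sequentially"
    if "\<epsilon> > 0" for \<epsilon>
  proof -
    define A where "A N = {\<omega> \<in> space M. \<bar>?S N \<omega> - real N * \<mu>\<bar> \<ge> real N * \<epsilon>}" for N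
    have [measurable]: "A N \<in> sets M" for N
      unfolding A_def by measurable
    have prob_A: "prob (A N) \<le> 2 * exp (-2 * \<epsilon>\<^sup>2) ^ N" for N
    proof (cases "N = 0")
      case True
      then show ?thesis using prob_le_1[of "A 0"] by (simp del: prob_le_1)
    next
      case False
      interpret H: Hoeffding_ineq M "{..<N}" X "\<lambda>_. 0" "\<lambda>_. 1" "real N * \<mu>"
        by unfold_locales
          (use indep_vars_subset[OF indep] bounded mean in \<open>auto intro!: AE_I2\<close>)
      have "prob (A N) \<le> 2 * exp (- 2 * (real N * \<epsilon>)\<^sup>2 / (\<Sum>i<N. (1 - 0)\<^sup>2))"
        unfolding A_def using that False by (intro H.Hoeffding_ineq_abs_ge) auto
      also have "- 2 * (real N * \<epsilon>)\<^sup>2 / (\<Sum>i<N. (1 - 0)\<^sup>2) = real N * (-2 * \<epsilon>\<^sup>2)"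
        using False by (simp add: power2_eq_square)
      finally show ?thesis by (simp only: exp_of_nat_mult)
    qed
    have "summable (\<lambda>N. 2 * exp (-2 * \<epsilon>\<^sup>2) ^ N)"
      using that by (intro summable_mult summable_geometric) simp
    then have "summable (\<lambda>N. prob (A N))"
      by (rule summable_comparison_test'[where N = 0]) (use prob_A in simp)
    then have "AE \<omega> in M. eventually (\<lambda>N. \<omega> \<in> space M - A N) sequentially"
      by (intro borel_cantelli_AE1) (auto simp: less_top[symmetric] emeasure_eq_measure)
    then show ?thesis
    proof (rule AE_mp, intro AE_I2 impI)
      fix \<omega> assume "\<omega> \<in> space M" and "eventually (\<lambda>N. \<omega> \<in> space M - A N) sequentially"
      from this(2) eventually_gt_at_top[of 0]
      show "eventually (\<lambda>N. \<bar>?S N \<omega> / real N - \<mu>\<bar> < \<epsilon>) sequentially"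
      proof eventually_elim
        case (elim N)
        then have "\<bar>?S N \<omega> - real N * \<mu>\<bar> < real N * \<epsilon>" by (auto simp: A_def)
        moreover have "?S N \<omega> / real N - \<mu> = (?S N \<omega> - real N * \<mu>) / real N"
          using elim by (simp add: field_simps)
        ultimately show ?case
          using elim by (simp add: abs_divide pos_divide_less_eq mult.commute)
      qed
    qed
  qed
  have "AE \<omega> in M. \<forall>k. eventually (\<lambda>N. \<bar>?S N \<omega> / real N - \<mu>\<bar> < 1 / real (Suc k)) sequentially"
    unfolding AE_all_countable by (intro allI close) simp
  then show ?thesis
  proof (rule AE_mp, intro AE_I2 impI)
    fix \<omega> assume *: "\<forall>k. eventually (\<lambda>N. \<bar>?S N \<omega> / real N - \<mu>\<bar> < 1 / real (Suc k)) sequentially"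
    show "(\<lambda>N. ?S N \<omega> / real N) \<longlonglongrightarrow> \<mu>"
    proof (rule tendstoI)
      fix e :: real assume "e > 0"
      then obtain k where k: "1 / real (Suc k) < e" using nat_approx_posE by blast
      show "eventually (\<lambda>N. dist (?S N \<omega> / real N) \<mu> < e) sequentially"
        using *[rule_format, of k] by eventually_elim (use k in \<open>simp add: dist_real_def\<close>)
    qed
  qed
qed

lemma tendsto_in_prob_if_AE:
  assumes [measurable]: "\<And>N. random_variable borel (Z N)"
    and lim: "AE \<omega> in M. (\<lambda>N. Z N \<omega>) \<longlonglongrightarrow> c"
  shows "tendsto_in_prob M Z c"
  unfolding tendsto_in_prob_def
proof (intro allI impI)
  fix \<epsilon> :: real assume "\<epsilon> > 0"
  let ?A = "\<lambda>N. {\<omega> \<in> space M. \<epsilon> < \<bar>Z N \<omega> - c\<bar>}"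
  have "(\<lambda>N. expectation (indicator (?A N))) \<longlonglongrightarrow> expectation (\<lambda>_. 0 :: real)"
  proof (rule integral_dominated_convergence[where w = "\<lambda>_. 1"])
    show "AE \<omega> in M. (\<lambda>N. indicator (?A N) \<omega>) \<longlonglongrightarrow> (0 :: real)"
      using lim
    proof (rule AE_mp, intro AE_I2 impI)
      fix \<omega> assume "(\<lambda>N. Z N \<omega>) \<longlonglongrightarrow> c"
      then have "eventually (\<lambda>N. dist (Z N \<omega>) c < \<epsilon>) sequentially"
        using \<open>\<epsilon> > 0\<close> by (rule tendstoD)
      then have "eventually (\<lambda>N. indicator (?A N) \<omega> = (0 :: real)) sequentially"
        by eventually_elim (auto simp: dist_real_def)
      then show "(\<lambda>N. indicator (?A N) \<omega>) \<longlonglongrightarrow> (0 :: real)"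
        by (rule tendsto_eventually)
    qed
  qed (auto simp: indicator_def)
  then show "(\<lambda>N. prob (?A N)) \<longlonglongrightarrow> 0" by simp
qed

end

lemma
  assumes "\<sigma> \<ge> 0"
  shows real_distribution_centred_normal: "real_distribution (centred_normal \<sigma>)"
    and char_centred_normal: "char (centred_normal \<sigma>) t = exp (- (\<sigma> * t)\<^sup>2 / 2)"
proof -
  have "real_distribution (centred_normal \<sigma>) \<and> char (centred_normal \<sigma>) t = exp (- (\<sigma> * t)\<^sup>2 / 2)"
  proof (cases "\<sigma> = 0")
    case True
    then show ?thesis
      by (auto simp: centred_normal_def char_def integral_return real_distribution_def
          real_distribution_axioms_def intro: prob_space_return)
  next
    case False
    then have pos: "\<sigma> > 0" using assms by simp
    interpret N: prob_space std_normal_distribution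
      using real_dist_normal_dist by (simp add: real_distribution_def)
    have "distributed std_normal_distribution lborel (\<lambda>x. x) std_normal_density"
      by (auto simp: distributed_def distr_id2)
    then have "distributed std_normal_distribution lborel (\<lambda>x. 0 + \<sigma> * x)
        (normal_density (0 + \<sigma> * 0) (\<bar>\<sigma>\<bar> * 1))"
      using pos by (intro N.normal_density_affine) auto
    then have eq: "centred_normal \<sigma> = distr std_normal_distribution borel (\<lambda>x. \<sigma> * x)"
      using pos by (simp add: centred_normal_def distributed_def cong: distr_cong)
    show ?thesis
    proof
      show "real_distribution (centred_normal \<sigma>)"
        unfolding eq by (rule N.real_distribution_distr) simp
      have "char (centred_normal \<sigma>) t = N.expectation (\<lambda>x. iexp (t * (\<sigma> * x)))"
        unfolding eq by (rule N.char_distr_eq) simp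
      also have "\<dots> = char std_normal_distribution (\<sigma> * t)"
      proof -
        have "t * (\<sigma> * x) = \<sigma> * t * x" for x :: real by simp
        then show ?thesis unfolding char_def by (simp only:)
      qed
      finally show "char (centred_normal \<sigma>) t = exp (- (\<sigma> * t)\<^sup>2 / 2)"
        by (simp add: char_std_normal_distribution)
    qed
  qed
  then show "real_distribution (centred_normal \<sigma>)"
    "char (centred_normal \<sigma>) t = exp (- (\<sigma> * t)\<^sup>2 / 2)" by auto
qed

section \<open>Samples attached to the vertices\<close>

text \<open>
  Absolute continuity of the law of \<open>X\<close> makes the faces of the cubes negligible.
\<close>

locale tree_sample = prob_space M for M :: "'a measure" +
  fixes X :: "'a \<Rightarrow> real ^ 'd::finite" and Y :: "'d vertex \<Rightarrow> nat \<Rightarrow> 'a \<Rightarrow> real ^ 'd"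
  assumes X_rv [measurable]: "random_variable borel X"
    and X_in_unit_cube: "\<And>\<omega>. \<omega> \<in> space M \<Longrightarrow> X \<omega> \<in> unit_cube"
    and X_continuous: "absolutely_continuous lborel (distr M borel X)"
    and sample_law: "\<And>v i. v \<in> vertices \<Longrightarrow> cube_prob M X v > 0 \<Longrightarrow> 1 \<le> i \<Longrightarrow>
          distr M borel (Y v i) = uniform_measure (distr M borel X) (cube v)"
    and sample_indep: "indep_vars (\<lambda>_. borel) (\<lambda>(v, i). Y v i)
          ({v \<in> vertices. cube_prob M X v > 0} \<times> {1..})"
begin

abbreviation "mass \<equiv> cube_prob M X"

definition charged_vertices :: "'d vertex set" where "charged_vertices = {v \<in> vertices. mass v > 0}"

text \<open>
  The probability of passing to \<open>v\<close> from its parent, which the frequencies estimate.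
\<close>

definition ratio :: "'d vertex \<Rightarrow> real" where "ratio v = mass v / mass (parent v)"

lemma mass_mono: "anc_le v u \<Longrightarrow> mass u \<le> mass v"
  unfolding cube_prob_def anc_le_def by (intro finite_measure_mono) auto

lemma mass_root: "mass root_vertex = 1"
proof -
  have "{\<omega> \<in> space M. X \<omega> \<in> cube root_vertex} = space M"
    using X_in_unit_cube by (auto simp: cube_root)
  then show ?thesis by (simp add: cube_prob_def prob_space)
qed

lemma same_depth_overlap:
  assumes "depth v = depth w" "v \<noteq> w"
  shows "measure (distr M borel X) (cube v \<inter> cube w) = 0"
  using cubes_same_depth_overlap[OF assms] X_continuous
  by (intro measure_eq_0_null_sets) (auto simp: absolutely_continuous_def)

lemma incomparable_overlap:
  assumes "u \<in> vertices" "v \<in> vertices" "\<not> anc_le u v" "\<not> anc_le v u"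
  shows "AE \<omega> in M. X \<omega> \<notin> cube u \<or> X \<omega> \<notin> cube v"
proof -
  obtain x y where xy: "depth x = depth y" "anc_le x u" "anc_le y v" "x \<noteq> y"
    using unique_sibling_pair[OF assms] by metis
  have "{\<omega> \<in> space M. X \<omega> \<in> cube x \<inter> cube y} \<in> null_sets M"
  proof -
    have "cube x \<inter> cube y \<in> null_sets (distr M borel X)"
      using cubes_same_depth_overlap[OF xy(1,4)] X_continuous
      by (auto simp: absolutely_continuous_def)
    then have "X -` (cube x \<inter> cube y) \<inter> space M \<in> null_sets M"
      by (simp add: null_sets_distr_iff)
    then show ?thesis by (simp add: vimage_def Int_def conj_ac)
  qed
  then show ?thesis
    by (rule AE_I') (use xy(2,3) in \<open>auto simp: anc_le_def\<close>)
qed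

text \<open>
  The cubes of an antichain are disjoint up to null sets, so their masses add up.
\<close>

lemma sum_mass_le:
  assumes "finite S" "S \<subseteq> vertices" and anti: "\<And>u u'. u \<in> S \<Longrightarrow> u' \<in> S \<Longrightarrow> anc_le u u' \<Longrightarrow> u = u'"
    and A: "A \<in> events" "\<And>v \<omega>. v \<in> S \<Longrightarrow> \<omega> \<in> space M \<Longrightarrow> X \<omega> \<in> cube v \<Longrightarrow> \<omega> \<in> A"
  shows "(\<Sum>v\<in>S. mass v) \<le> prob A"
proof -
  let ?F = "\<lambda>v. {\<omega> \<in> space M. X \<omega> \<in> cube v}"
  have "prob (\<Union>v\<in>S. ?F v) = (\<Sum>v\<in>S. prob (?F v))"
  proof (rule measure_UNION_AE[OF \<open>finite S\<close>])
    show "pairwise (\<lambda>u v. AE \<omega> in M. \<omega> \<notin> ?F u \<or> \<omega> \<notin> ?F v) S"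
    proof (rule pairwiseI)
      fix u v assume "u \<in> S" "v \<in> S" "u \<noteq> v"
      then have "AE \<omega> in M. X \<omega> \<notin> cube u \<or> X \<omega> \<notin> cube v"
        using assms(2) anti by (intro incomparable_overlap) blast+
      then show "AE \<omega> in M. \<omega> \<notin> ?F u \<or> \<omega> \<notin> ?F v" by (rule AE_mp) auto
    qed
  qed (simp_all add: fmeasurable_eq_sets)
  then have "(\<Sum>v\<in>S. mass v) = prob (\<Union>v\<in>S. ?F v)"
    by (simp add: cube_prob_def)
  also have "\<dots> \<le> prob A"
    using A by (intro finite_measure_mono) auto
  finally show ?thesis .
qed

lemma prob_le_sum_mass:
  assumes "finite S" and A: "\<And>\<omega>. \<omega> \<in> A \<Longrightarrow> \<omega> \<in> space M \<and> (\<exists>v\<in>S. X \<omega> \<in> cube v)"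
  shows "prob A \<le> (\<Sum>v\<in>S. mass v)"
proof -
  let ?F = "\<lambda>v. {\<omega> \<in> space M. X \<omega> \<in> cube v}"
  have "prob A \<le> prob (\<Union>v\<in>S. ?F v)"
    using A \<open>finite S\<close> by (intro finite_measure_mono sets.finite_UN) auto
  also have "\<dots> \<le> (\<Sum>v\<in>S. prob (?F v))"
    by (rule finite_measure_subadditive_finite) (use \<open>finite S\<close> in auto)
  finally show ?thesis by (simp add: cube_prob_def)
qed

lemma charged_upward: "u \<in> charged_vertices \<Longrightarrow> v \<in> vertices \<Longrightarrow> anc_le v u \<Longrightarrow> v \<in> charged_vertices"
  using mass_mono[of v u] by (simp add: charged_vertices_def)

lemma charged_ancestors: "u \<in> charged_vertices \<Longrightarrow> ancestors u \<subseteq> charged_vertices"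
  unfolding ancestors_def using charged_upward by blast

lemma charged_parent: "v \<in> charged_vertices \<Longrightarrow> v \<noteq> root_vertex \<Longrightarrow> parent v \<in> charged_vertices"
  using charged_upward[of v "parent v"] parent_anc_le[of v] parent_in_vertices[of v] by (simp add: charged_vertices_def)

lemma ancestorsD:
  assumes "u \<in> charged_vertices" "v \<in> ancestors u"
  shows "v \<in> charged_vertices" "v \<noteq> root_vertex"
  using assms charged_ancestors[of u] by (auto simp: ancestors_def)

lemma ratio_pos: "v \<in> charged_vertices \<Longrightarrow> v \<noteq> root_vertex \<Longrightarrow> 0 < ratio v"
  using charged_parent[of v] by (simp add: ratio_def charged_vertices_def)

lemma ratio_le_1: "v \<in> charged_vertices \<Longrightarrow> v \<noteq> root_vertex \<Longrightarrow> ratio v \<le> 1"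
  using charged_parent[of v] mass_mono[OF parent_anc_le, of v] by (simp add: ratio_def charged_vertices_def)

lemma prod_ratio: "u \<in> charged_vertices \<Longrightarrow> (\<Prod>v\<in>ancestors u. ratio v) = mass u"
proof (induction "depth u" arbitrary: u)
  case 0
  then have "u = root_vertex" by (simp add: charged_vertices_def depth_0_iff)
  then show ?case by (simp add: mass_root)
next
  case (Suc k)
  then have u: "u \<in> vertices" "u \<noteq> root_vertex" by (auto simp: charged_vertices_def)
  have "parent u \<in> charged_vertices" "depth (parent u) = k"
    using Suc charged_parent u depth_parent[OF u] by auto
  with Suc have "(\<Prod>v\<in>ancestors (parent u). ratio v) = mass (parent u)" by simp
  moreover have "mass (parent u) > 0" using \<open>parent u \<in> charged_vertices\<close> by (simp add: charged_vertices_def)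
  ultimately show ?case
    using ancestors_insert[OF u] finite_ancestors[of "parent u"] parent_in_vertices[OF u]
    by (simp add: ratio_def)
qed

lemma Y_rv:
  assumes "w \<in> charged_vertices" "1 \<le> i"
  shows "random_variable borel (Y w i)"
proof -
  have "(w, i) \<in> {v \<in> vertices. mass v > 0} \<times> {1..}"
    using assms by (simp add: charged_vertices_def)
  then have "random_variable borel (case (w, i) of (v, j) \<Rightarrow> Y v j)"
    using sample_indep unfolding indep_vars_def by blast
  then show ?thesis by simp
qed

lemma prob_sample:
  assumes "w \<in> charged_vertices" "1 \<le> i" "A \<in> sets borel"
  shows "prob {\<omega> \<in> space M. Y w i \<omega> \<in> A} = measure (distr M borel X) (cube w \<inter> A) / mass w"
proof -
  interpret D: prob_space "distr M borel X" by (rule prob_space_distr) simp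
  have m: "measure (distr M borel X) (cube w) = mass w"
    by (simp add: measure_distr cube_prob_def vimage_def Int_def conj_commute)
  have "prob {\<omega> \<in> space M. Y w i \<omega> \<in> A} = measure (distr M borel (Y w i)) A"
    using assms Y_rv by (simp add: measure_distr vimage_def Int_def conj_commute)
  also have "\<dots> = measure (uniform_measure (distr M borel X) (cube w)) A"
    using assms by (simp add: sample_law charged_vertices_def)
  also have "\<dots> = measure (distr M borel X) (cube w \<inter> A) / mass w"
    using assms m by (subst measure_uniform_measure) (auto simp: charged_vertices_def D.emeasure_eq_measure)
  finally show ?thesis .
qed

section \<open>Moments of the indicators\<close>

text \<open>
  The samples are counted from \<open>0\<close> here, which is the indexing of the limit theorems.
\<close>

definition hit :: "'d vertex \<Rightarrow> nat \<Rightarrow> 'a \<Rightarrow> real" where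
  "hit v i \<omega> = indicator (cube v) (Y (parent v) (Suc i) \<omega>)"

lemma hit_bounds: "0 \<le> hit v i \<omega>" "hit v i \<omega> \<le> 1"
  by (simp_all add: hit_def indicator_def)

lemma hit_rv:
  assumes "v \<in> charged_vertices" "v \<noteq> root_vertex"
  shows "random_variable borel (hit v i)"
proof -
  note [measurable] = Y_rv[OF charged_parent[OF assms], of "Suc i", simplified]
  show ?thesis unfolding hit_def[abs_def] by measurable
qed

lemma hit_integrable: "v \<in> charged_vertices \<Longrightarrow> v \<noteq> root_vertex \<Longrightarrow> integrable M (hit v i)"
  using hit_rv hit_bounds by (intro integrable_const_bound[where B = 1]) auto

lemma expectation_hit:
  assumes "v \<in> charged_vertices" "v \<noteq> root_vertex"
  shows "expectation (hit v i) = ratio v"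
proof -
  have v: "v \<in> vertices" using assms by (simp add: charged_vertices_def)
  have "expectation (hit v i) = expectation (indicator {\<omega> \<in> space M. Y (parent v) (Suc i) \<omega> \<in> cube v})"
    by (intro Bochner_Integration.integral_cong) (auto simp: hit_def indicator_def)
  also have "\<dots> = measure (distr M borel X) (cube (parent v) \<inter> cube v) / mass (parent v)"
    using Y_rv[OF charged_parent[OF assms], of "Suc i"]
    by (simp add: prob_sample charged_parent assms)
  also have "cube (parent v) \<inter> cube v = cube v"
    using parent_anc_le[OF v assms(2)] by (auto simp: anc_le_def)
  also have "measure (distr M borel X) (cube v) = mass v"
    by (simp add: measure_distr cube_prob_def vimage_def Int_def conj_commute)
  finally show ?thesis by (simp add: ratio_def)
qed

lemma expectation_hit_siblings:
  assumes "v \<in> charged_vertices" "v \<noteq> root_vertex" "v' \<in> charged_vertices" "v' \<noteq> root_vertex" "v \<noteq> v'" "parent v = parent v'"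
  shows "expectation (\<lambda>\<omega>. hit v i \<omega> * hit v' i \<omega>) = 0"
proof -
  let ?w = "parent v"
  interpret D: prob_space "distr M borel X" by (rule prob_space_distr) simp
  have "expectation (\<lambda>\<omega>. hit v i \<omega> * hit v' i \<omega>)
      = expectation (indicator {\<omega> \<in> space M. Y ?w (Suc i) \<omega> \<in> cube v \<inter> cube v'})"
    using assms(6)
    by (intro Bochner_Integration.integral_cong) (auto simp: hit_def indicator_def)
  also have "\<dots> = measure (distr M borel X) (cube ?w \<inter> (cube v \<inter> cube v')) / mass ?w"
    using Y_rv[OF charged_parent, of v "Suc i"] assms
    by (subst prob_sample[symmetric]) (auto simp: charged_parent)
  also have "measure (distr M borel X) (cube ?w \<inter> (cube v \<inter> cube v')) = 0"
  proof -
    have "depth v = depth v'"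
      using assms depth_parent[of v] depth_parent[of v'] by (simp add: charged_vertices_def)
    then have "measure (distr M borel X) (cube v \<inter> cube v') = 0"
      using same_depth_overlap assms(5) by blast
    moreover have "measure (distr M borel X) (cube ?w \<inter> (cube v \<inter> cube v'))
        \<le> measure (distr M borel X) (cube v \<inter> cube v')"
      by (rule D.finite_measure_mono) auto
    ultimately show ?thesis by (simp add: measure_le_0_iff)
  qed
  finally show ?thesis by simp
qed

text \<open>
  Different parents have independent samples.
\<close>

lemma expectation_hit_strangers:
  assumes "v \<in> charged_vertices" "v \<noteq> root_vertex" "v' \<in> charged_vertices" "v' \<noteq> root_vertex" "parent v \<noteq> parent v'"
  shows "expectation (\<lambda>\<omega>. hit v i \<omega> * hit v' i \<omega>) = ratio v * ratio v'"
proof -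
  let ?a = "(parent v, Suc i)" and ?b = "(parent v', Suc i)"
  define F :: "'d vertex \<times> nat \<Rightarrow> real ^ 'd \<Rightarrow> real" where
    "F p = (if p = ?a then indicator (cube v) else indicator (cube v'))" for p
  define Z where "Z p \<omega> = F p (case p of (w, j) \<Rightarrow> Y w j \<omega>)" for p \<omega>
  have "indep_vars (\<lambda>_. borel) (\<lambda>(w, j). Y w j) {?a, ?b}"
    using assms charged_parent by (intro indep_vars_subset[OF sample_indep]) (auto simp: charged_vertices_def)
  then have "indep_vars (\<lambda>_. borel) (\<lambda>p \<omega>. F p ((case p of (w, j) \<Rightarrow> Y w j) \<omega>)) {?a, ?b}"
    by (rule indep_vars_compose2) (auto simp: F_def)
  also have "(\<lambda>p \<omega>. F p ((case p of (w, j) \<Rightarrow> Y w j) \<omega>)) = Z"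
    by (auto simp: Z_def fun_eq_iff)
  finally have indep: "indep_vars (\<lambda>_. borel) Z {?a, ?b}" .
  have Z: "Z ?a = hit v i" "Z ?b = hit v' i"
    using assms(5) by (auto simp: Z_def F_def hit_def fun_eq_iff)
  have "integrable M (Z p)" if "p \<in> {?a, ?b}" for p
    using that Z hit_integrable[of v i] hit_integrable[of v' i] assms by auto
  then have "expectation (\<lambda>\<omega>. Z ?a \<omega> * Z ?b \<omega>) = expectation (Z ?a) * expectation (Z ?b)"
    using assms(5) by (intro indep_vars_expectation_mult[OF indep]) auto
  then show ?thesis
    using assms by (simp add: Z expectation_hit)
qed

text \<open>
  The derivative of \<open>p\<^sub>N(u)\<close> in \<open>q\<^sub>N(v)\<close> at the true values is \<open>mass u / ratio v\<close>; with errors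
  measured relative to \<open>ratio v\<close>, all derivatives along the path to \<open>u\<close> equal \<open>mass u\<close>.
\<close>

definition rel_err :: "'d vertex \<Rightarrow> nat \<Rightarrow> 'a \<Rightarrow> real" where
  "rel_err v i \<omega> = (hit v i \<omega> - ratio v) / ratio v"

lemma rel_err_integrable: "v \<in> charged_vertices \<Longrightarrow> v \<noteq> root_vertex \<Longrightarrow> integrable M (rel_err v i)"
  unfolding rel_err_def[abs_def] by (intro integrable_divide Bochner_Integration.integrable_diff hit_integrable) auto

lemma expectation_rel_err: "v \<in> charged_vertices \<Longrightarrow> v \<noteq> root_vertex \<Longrightarrow> expectation (rel_err v i) = 0"
  using hit_integrable[of v i] by (simp add: rel_err_def[abs_def] expectation_hit prob_space)

lemma hit_mult_integrable:
  assumes "v \<in> charged_vertices" "v \<noteq> root_vertex" "v' \<in> charged_vertices" "v' \<noteq> root_vertex"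
  shows "integrable M (\<lambda>\<omega>. hit v i \<omega> * hit v' i \<omega>)"
proof -
  note [measurable] = hit_rv[of v i, OF assms(1,2)] hit_rv[of v' i, OF assms(3,4)]
  show ?thesis
    using hit_bounds[of v i] hit_bounds[of v' i]
    by (intro integrable_const_bound[where B = 1]) (auto intro!: AE_I2 mult_le_one)
qed

lemma rel_err_mult: "rel_err v i \<omega> * rel_err v' i \<omega> = (hit v i \<omega> * hit v' i \<omega> - ratio v * hit v' i \<omega>
    - ratio v' * hit v i \<omega> + ratio v * ratio v') / (ratio v * ratio v')"
  by (simp add: rel_err_def algebra_simps)

lemma rel_err_mult_integrable:
  assumes "v \<in> charged_vertices" "v \<noteq> root_vertex" "v' \<in> charged_vertices" "v' \<noteq> root_vertex"
  shows "integrable M (\<lambda>\<omega>. rel_err v i \<omega> * rel_err v' i \<omega>)"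
  unfolding rel_err_mult using hit_mult_integrable[OF assms, of i] hit_integrable[of _ i] assms by auto

text \<open>
  The covariance of the relative errors at the same sample index.
\<close>

definition cov :: "'d vertex \<Rightarrow> 'd vertex \<Rightarrow> real" where
  "cov v v' = (if v = v' then (1 - ratio v) / ratio v else if parent v = parent v' then -1 else 0)"

lemma expectation_rel_err_mult:
  assumes "v \<in> charged_vertices" "v \<noteq> root_vertex" "v' \<in> charged_vertices" "v' \<noteq> root_vertex"
  shows "expectation (\<lambda>\<omega>. rel_err v i \<omega> * rel_err v' i \<omega>) = cov v v'"
proof -
  have q: "ratio v > 0" "ratio v' > 0" using ratio_pos assms by auto
  have "expectation (\<lambda>\<omega>. rel_err v i \<omega> * rel_err v' i \<omega>)
      = (expectation (\<lambda>\<omega>. hit v i \<omega> * hit v' i \<omega>) - ratio v * ratio v') / (ratio v * ratio v')"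
    unfolding rel_err_mult
    using hit_mult_integrable[OF assms, of i] hit_integrable[of _ i] assms
    by (simp add: expectation_hit prob_space)
  moreover have "expectation (\<lambda>\<omega>. hit v i \<omega> * hit v i \<omega>) = ratio v"
  proof -
    have *: "(\<lambda>\<omega>. hit v i \<omega> * hit v i \<omega>) = hit v i" by (auto simp: hit_def indicator_def)
    show ?thesis unfolding * by (rule expectation_hit[OF assms(1,2)])
  qed
  moreover have "(a - a * a) / (a * a) = (1 - a) / a" if "0 < a" for a :: real
    using that by (simp add: field_simps)
  ultimately show ?thesis
    using q expectation_hit_siblings[OF assms, of i] expectation_hit_strangers[OF assms, of i]
    by (cases "v = v'"; cases "parent v = parent v'") (auto simp: cov_def)
qed

section \<open>The sequence of sample points is i.i.d.\<close>

text \<open>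
  The \<open>i\<close>-th points of all samples together. Rows are independent of each other and equally
  distributed, and hence so are the values of any measurable function of the row; this gives
  the i.i.d. sequences to which the limit theorems are applied.
\<close>

definition row :: "nat \<Rightarrow> 'a \<Rightarrow> 'd vertex \<Rightarrow> real ^ 'd" where
  "row i \<omega> = (\<lambda>w\<in>charged_vertices. Y w (Suc i) \<omega>)"

lemma sample_indep_charged: "indep_vars (\<lambda>_. borel) (\<lambda>(v, i). Y v i) (charged_vertices \<times> {1..})"
  using sample_indep by (simp add: charged_vertices_def)

lemma row_indep: "indep_vars (\<lambda>_. PiM charged_vertices (\<lambda>_. borel)) row UNIV"
proof -
  have "indep_vars (\<lambda>i. PiM (charged_vertices \<times> {Suc i}) (\<lambda>_. borel))
      (\<lambda>i \<omega>. restrict (\<lambda>p. (case p of (v, j) \<Rightarrow> Y v j) \<omega>) (charged_vertices \<times> {Suc i})) UNIV"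
    by (rule indep_vars_restrict[OF sample_indep_charged]) (auto simp: disjoint_family_on_def)
  then have "indep_vars (\<lambda>_. PiM charged_vertices (\<lambda>_. borel))
      (\<lambda>i \<omega>. (\<lambda>w\<in>charged_vertices. (restrict (\<lambda>p. (case p of (v, j) \<Rightarrow> Y v j) \<omega>) (charged_vertices \<times> {Suc i})) (w, Suc i))) UNIV"
    by (rule indep_vars_compose2[where Y = "\<lambda>i f. \<lambda>w\<in>charged_vertices. f (w, Suc i)"])
      (auto intro!: measurable_restrict measurable_component_singleton)
  also have "(\<lambda>i \<omega>. (\<lambda>w\<in>charged_vertices. (restrict (\<lambda>p. (case p of (v, j) \<Rightarrow> Y v j) \<omega>) (charged_vertices \<times> {Suc i})) (w, Suc i))) = row"
    by (auto simp: row_def fun_eq_iff)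
  finally show ?thesis .
qed

text \<open>
  By independence within the row its law is a product measure, which does not depend on \<open>i\<close>.
\<close>

lemma row_law:
  "distr M (PiM charged_vertices (\<lambda>_. borel)) (row i) = PiM charged_vertices (\<lambda>w. uniform_measure (distr M borel X) (cube w))"
proof -
  have "indep_vars (\<lambda>w. PiM {(w, Suc i)} (\<lambda>_. borel))
      (\<lambda>w \<omega>. restrict (\<lambda>p. (case p of (v, j) \<Rightarrow> Y v j) \<omega>) {(w, Suc i)}) charged_vertices"
    by (rule indep_vars_restrict[OF sample_indep_charged]) (auto simp: disjoint_family_on_def)
  then have "indep_vars (\<lambda>_. borel)
      (\<lambda>w \<omega>. (restrict (\<lambda>p. (case p of (v, j) \<Rightarrow> Y v j) \<omega>) {(w, Suc i)}) (w, Suc i)) charged_vertices"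
    by (rule indep_vars_compose2[where Y = "\<lambda>w f. f (w, Suc i)"])
      (auto intro!: measurable_component_singleton)
  then have "indep_vars (\<lambda>_. borel) (\<lambda>w. Y w (Suc i)) charged_vertices" by simp
  moreover have "root_vertex \<in> charged_vertices" by (simp add: charged_vertices_def mass_root)
  then have "charged_vertices \<noteq> {}" by blast
  ultimately have "distr M (PiM charged_vertices (\<lambda>_. borel)) (row i) = PiM charged_vertices (\<lambda>w. distr M borel (Y w (Suc i)))"
    unfolding row_def[abs_def] using Y_rv by (subst (asm) indep_vars_iff_distr_eq_PiM') auto
  also have "\<dots> = PiM charged_vertices (\<lambda>w. uniform_measure (distr M borel X) (cube w))"
    by (rule PiM_cong) (auto simp: sample_law charged_vertices_def)
  finally show ?thesis .
qed

lemma row_function_iid: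
  assumes [measurable]: "H \<in> borel_measurable (PiM charged_vertices (\<lambda>_. borel))"
  shows "indep_vars (\<lambda>_. borel) (\<lambda>i \<omega>. H (row i \<omega>)) UNIV"
    and "distr M borel (\<lambda>\<omega>. H (row i \<omega>)) = distr M borel (\<lambda>\<omega>. H (row 0 \<omega>))"
proof -
  show "indep_vars (\<lambda>_. borel) (\<lambda>i \<omega>. H (row i \<omega>)) UNIV"
    by (rule indep_vars_compose2[OF row_indep]) simp
  have rv: "row i \<in> measurable M (PiM charged_vertices (\<lambda>_. borel))" for i
    using row_indep by (simp add: indep_vars_def)
  have "distr M borel (\<lambda>\<omega>. H (row i \<omega>)) = distr (distr M (PiM charged_vertices (\<lambda>_. borel)) (row i)) borel H" for i
    using rv by (subst distr_distr) (auto simp: comp_def)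
  then show "distr M borel (\<lambda>\<omega>. H (row i \<omega>)) = distr M borel (\<lambda>\<omega>. H (row 0 \<omega>))"
    by (simp add: row_law)
qed

definition hit_of_row :: "'d vertex \<Rightarrow> ('d vertex \<Rightarrow> real ^ 'd) \<Rightarrow> real" where
  "hit_of_row v f = indicator (cube v) (f (parent v))"

lemma hit_of_row_measurable:
  assumes "v \<in> charged_vertices" "v \<noteq> root_vertex"
  shows "hit_of_row v \<in> borel_measurable (PiM charged_vertices (\<lambda>_. borel))"
proof -
  have [measurable]: "(\<lambda>f. f (parent v)) \<in> measurable (PiM charged_vertices (\<lambda>_. borel)) borel"
    using charged_parent[OF assms] by (rule measurable_component_singleton)
  show ?thesis unfolding hit_of_row_def[abs_def] by measurable
qed

lemma hit_eq_row:
  assumes "v \<in> charged_vertices" "v \<noteq> root_vertex"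
  shows "hit v i \<omega> = hit_of_row v (row i \<omega>)"
  using charged_parent[OF assms] by (simp add: hit_def hit_of_row_def row_def)

lemma hit_indep:
  assumes "v \<in> charged_vertices" "v \<noteq> root_vertex"
  shows "indep_vars (\<lambda>_. borel) (hit v) UNIV"
proof -
  have "hit v = (\<lambda>i \<omega>. hit_of_row v (row i \<omega>))"
    by (intro ext hit_eq_row assms)
  then show ?thesis
    using row_function_iid(1)[OF hit_of_row_measurable[OF assms]] by simp
qed

section \<open>Frequencies and their products\<close>

lemma q_est_eq: "q_est Y N v \<omega> = (\<Sum>i<N. hit v i \<omega>) / real N"
  by (simp add: q_est_def hit_def sum.atLeast1_atMost_eq)

lemma q_est_bounds: "0 \<le> q_est Y N v \<omega>" "q_est Y N v \<omega> \<le> 1"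
proof -
  show "0 \<le> q_est Y N v \<omega>"
    by (simp add: q_est_eq sum_nonneg hit_bounds)
  have "(\<Sum>i<N. hit v i \<omega>) \<le> real N"
    using sum_bounded_above[of "{..<N}" "\<lambda>i. hit v i \<omega>" 1] hit_bounds by simp
  then show "q_est Y N v \<omega> \<le> 1"
    by (cases "N = 0") (simp_all add: q_est_eq)
qed

lemma q_est_rv:
  "v \<in> charged_vertices \<Longrightarrow> v \<noteq> root_vertex \<Longrightarrow> random_variable borel (q_est Y N v)"
  unfolding q_est_eq[abs_def] using hit_rv by (intro borel_measurable_divide borel_measurable_sum) auto

lemma expectation_q_est:
  assumes "v \<in> charged_vertices" "v \<noteq> root_vertex" "1 \<le> N"
  shows "expectation (q_est Y N v) = ratio v"
  unfolding q_est_eq[abs_def] using assms hit_integrable[OF assms(1,2)]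
  by (simp add: expectation_hit)

lemma q_est_tendsto:
  assumes "v \<in> charged_vertices" "v \<noteq> root_vertex"
  shows "AE \<omega> in M. (\<lambda>N. q_est Y N v \<omega>) \<longlonglongrightarrow> ratio v"
  unfolding q_est_eq
  by (rule slln_bounded[OF hit_indep[OF assms]]) (use hit_bounds expectation_hit assms in auto)

lemma q_est_mean_square:
  assumes v: "v \<in> charged_vertices" "v \<noteq> root_vertex" and N: "1 \<le> N"
  shows "expectation (\<lambda>\<omega>. (q_est Y N v \<omega> - ratio v)\<^sup>2) \<le> 1 / real N"
proof -
  let ?D = "\<lambda>i \<omega>. hit v i \<omega> - ratio v"
  have q: "0 < ratio v" "ratio v \<le> 1" using ratio_pos ratio_le_1 v by auto
  have sq: "(?D i \<omega>)\<^sup>2 = (1 - 2 * ratio v) * hit v i \<omega> + (ratio v)\<^sup>2" for i \<omega>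
    by (auto simp: hit_def indicator_def power2_eq_square algebra_simps)
  have "expectation (\<lambda>\<omega>. (?D i \<omega>)\<^sup>2) = ratio v * (1 - ratio v)" for i
    unfolding sq using hit_integrable[OF v, of i] expectation_hit[OF v, of i]
    by (simp add: prob_space power2_eq_square algebra_simps)
  moreover have "indep_vars (\<lambda>_. borel) ?D UNIV"
    by (rule indep_vars_compose2[OF hit_indep[OF v]]) simp
  moreover have "\<bar>?D i \<omega>\<bar> \<le> 1" for i \<omega>
    using hit_bounds[of v i \<omega>] q by auto
  moreover have "expectation (?D i) = 0" for i
    using hit_integrable[OF v, of i] expectation_hit[OF v, of i] by (simp add: prob_space)
  ultimately have "expectation (\<lambda>\<omega>. (\<Sum>i<N. ?D i \<omega>)\<^sup>2) = real N * (ratio v * (1 - ratio v))"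
    by (intro second_moment_indep_sum[where C = 1]) auto
  moreover have "(q_est Y N v \<omega> - ratio v)\<^sup>2 = (\<Sum>i<N. ?D i \<omega>)\<^sup>2 / (real N)\<^sup>2" for \<omega>
  proof -
    have "q_est Y N v \<omega> - ratio v = (\<Sum>i<N. ?D i \<omega>) / real N"
      using N by (simp add: q_est_eq sum_subtractf diff_divide_distrib)
    then show ?thesis by (simp add: power_divide)
  qed
  ultimately have "expectation (\<lambda>\<omega>. (q_est Y N v \<omega> - ratio v)\<^sup>2)
      = real N * (ratio v * (1 - ratio v)) / (real N)\<^sup>2"
    by simp
  also have "\<dots> = ratio v * (1 - ratio v) / real N"
    using N by (simp add: power2_eq_square)
  also have "\<dots> \<le> 1 / real N"
    using q by (intro divide_right_mono mult_le_one) auto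
  finally show ?thesis .
qed

lemma p_est_rv: "u \<in> charged_vertices \<Longrightarrow> random_variable borel (p_est Y N u)"
  unfolding p_est_def[abs_def] using q_est_rv ancestorsD by (intro borel_measurable_prod) blast

lemma p_est_bounds: "0 \<le> p_est Y N u \<omega>" "p_est Y N u \<omega> \<le> 1"
  unfolding p_est_def using q_est_bounds by (auto intro!: prod_nonneg prod_le_1)

lemma p_est_integrable: "u \<in> charged_vertices \<Longrightarrow> integrable M (p_est Y N u)"
  using p_est_rv p_est_bounds by (intro integrable_const_bound[where B = 1]) auto

text \<open>
  The frequency of \<open>v\<close> is a function of the first \<open>N\<close> sample points of the parent of \<open>v\<close>. Along a
  path the parents are distinct, so the frequencies are independent and the expectation of their
  product telescopes.
\<close>

lemma expectation_p_est:
  assumes u: "u \<in> charged_vertices" and N: "1 \<le> N"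
  shows "expectation (p_est Y N u) = mass u"
proof -
  let ?K = "\<lambda>v. {parent v} \<times> {1..N}"
  have uv: "u \<in> vertices" using u by (simp add: charged_vertices_def)
  have "indep_vars (\<lambda>v. PiM (?K v) (\<lambda>_. borel))
      (\<lambda>v \<omega>. restrict (\<lambda>p. (case p of (w, j) \<Rightarrow> Y w j) \<omega>) (?K v)) (ancestors u)"
  proof (rule indep_vars_restrict[OF sample_indep_charged])
    show "?K v \<subseteq> charged_vertices \<times> {1..}" if "v \<in> ancestors u" for v
      using charged_parent[OF ancestorsD[OF u that]] by auto
    show "disjoint_family_on ?K (ancestors u)"
      unfolding disjoint_family_on_def
    proof (intro ballI impI)
      fix v w assume "v \<in> ancestors u" "w \<in> ancestors u" "v \<noteq> w"
      then have "parent v \<noteq> parent w"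
        using inj_on_parent_ancestors[OF uv] by (metis inj_onD)
      then show "?K v \<inter> ?K w = {}" by auto
    qed
  qed
  then have "indep_vars (\<lambda>_. borel)
      (\<lambda>v \<omega>. 1 / real N * (\<Sum>i = 1..N. indicator (cube v)
         ((restrict (\<lambda>p. (case p of (w, j) \<Rightarrow> Y w j) \<omega>) (?K v)) (parent v, i)))) (ancestors u)"
  proof (rule indep_vars_compose2[where Y = "\<lambda>v f. 1 / real N * (\<Sum>i = 1..N. indicator (cube v) (f (parent v, i)))"])
    fix v assume "v \<in> ancestors u"
    have [measurable]: "(\<lambda>f. f (parent v, i)) \<in> measurable (PiM (?K v) (\<lambda>_. borel)) borel"
      if "i \<in> {1..N}" for i
      using that by (intro measurable_component_singleton) auto
    show "(\<lambda>f. 1 / real N * (\<Sum>i = 1..N. indicator (cube v) (f (parent v, i))))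
        \<in> borel_measurable (PiM (?K v) (\<lambda>_. borel))"
      by measurable
  qed
  also have "(\<lambda>v \<omega>. 1 / real N * (\<Sum>i = 1..N. indicator (cube v)
         ((restrict (\<lambda>p. (case p of (w, j) \<Rightarrow> Y w j) \<omega>) (?K v)) (parent v, i)))) = q_est Y N"
    by (auto simp: fun_eq_iff q_est_def intro!: sum.cong)
  finally have indep: "indep_vars (\<lambda>_. borel) (q_est Y N) (ancestors u)" .
  have int: "integrable M (q_est Y N v)" if "v \<in> ancestors u" for v
    using q_est_rv[OF ancestorsD[OF u that]] q_est_bounds
    by (intro integrable_const_bound[where B = 1]) auto
  have "expectation (p_est Y N u) = (\<Prod>v\<in>ancestors u. expectation (q_est Y N v))"
    unfolding p_est_def[abs_def]
    by (rule indep_vars_lebesgue_integral[OF finite_ancestors[OF uv] indep int])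
  also have "\<dots> = (\<Prod>v\<in>ancestors u. ratio v)"
    using ancestorsD[OF u] N by (intro prod.cong) (auto simp: expectation_q_est)
  finally show ?thesis using u by (simp add: prod_ratio)
qed

lemma p_est_tendsto:
  assumes "u \<in> charged_vertices" "\<And>v. v \<in> ancestors u \<Longrightarrow> (\<lambda>N. q_est Y N v \<omega>) \<longlonglongrightarrow> ratio v"
  shows "(\<lambda>N. p_est Y N u \<omega>) \<longlonglongrightarrow> mass u"
  unfolding p_est_def prod_ratio[OF assms(1), symmetric] using assms(2) by (rule tendsto_prod)

section \<open>The asymptotic variance\<close>

text \<open>
  The contribution of the \<open>i\<close>-th row to the linearised estimator.
\<close>

definition influence :: "'d vertex set \<Rightarrow> nat \<Rightarrow> 'a \<Rightarrow> real" where
  "influence C i \<omega> = (\<Sum>u\<in>C. mass u * (\<Sum>v\<in>ancestors u. rel_err v i \<omega>))"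

text \<open>
  The estimator of the variance with the frequencies replaced by the true ratios.
\<close>

definition asymptotic_variance :: "'d vertex set \<Rightarrow> real" where
  "asymptotic_variance C =
     (\<Sum>u\<in>C. (mass u)\<^sup>2 * (\<Sum>v\<in>ancestors u. (1 - ratio v) / ratio v)) +
     (\<Sum>(u, u')\<in>{(u, u'). u \<in> C \<and> u' \<in> C \<and> u \<noteq> u'}. mass u * mass u' *
        ((\<Sum>v\<in>ancestors (common_ancestor u u'). (1 - ratio v) / ratio v) - 1))"

text \<open>
  The common ancestors contribute their variances. Covariances of distinct vertices come from
  siblings only, and two incomparable paths contain one pair of these.
\<close>

lemma sum_cov_ancestors:
  assumes u: "u \<in> vertices" and u': "u' \<in> vertices"
    and anti: "u \<noteq> u' \<Longrightarrow> \<not> anc_le u u' \<and> \<not> anc_le u' u"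
  shows "(\<Sum>v\<in>ancestors u. \<Sum>v'\<in>ancestors u'. cov v v') =
    (\<Sum>v\<in>ancestors u \<inter> ancestors u'. (1 - ratio v) / ratio v) - (if u = u' then 0 else 1)"
proof -
  let ?P = "\<lambda>v v'. v \<noteq> v' \<and> parent v = parent v'"
  note fin = finite_ancestors[OF u] finite_ancestors[OF u']
  have "cov v v' = (if v = v' then (1 - ratio v) / ratio v else 0) - (if ?P v v' then 1 else 0)" for v v'
    by (simp add: cov_def)
  then have "(\<Sum>v\<in>ancestors u. \<Sum>v'\<in>ancestors u'. cov v v') =
      (\<Sum>v\<in>ancestors u. \<Sum>v'\<in>ancestors u'. if v = v' then (1 - ratio v) / ratio v else 0) -
      (\<Sum>v\<in>ancestors u. \<Sum>v'\<in>ancestors u'. if ?P v v' then 1 else 0)"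
    by (simp only: sum_subtractf)
  also have "(\<Sum>v\<in>ancestors u. \<Sum>v'\<in>ancestors u'. if v = v' then (1 - ratio v) / ratio v else 0)
      = (\<Sum>v\<in>ancestors u \<inter> ancestors u'. (1 - ratio v) / ratio v)"
    using fin by (simp add: sum.inter_restrict)
  also have "(\<Sum>v\<in>ancestors u. \<Sum>v'\<in>ancestors u'. if ?P v v' then 1 else (0::real))
      = (\<Sum>(v, v')\<in>ancestors u \<times> ancestors u'. if ?P v v' then 1 else 0)"
    by (simp add: sum.cartesian_product)
  also have "\<dots> = (\<Sum>z\<in>ancestors u \<times> ancestors u'. if ?P (fst z) (snd z) then 1 else 0)"
    by (intro sum.cong) auto
  also have "\<dots> = real (card {z \<in> ancestors u \<times> ancestors u'. ?P (fst z) (snd z)})"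
    using fin by (subst sum.inter_filter[symmetric]) auto
  also have "{z \<in> ancestors u \<times> ancestors u'. ?P (fst z) (snd z)}
      = {(v, v') \<in> ancestors u \<times> ancestors u'. ?P v v'}"
    by auto
  also have "real (card \<dots>) = (if u = u' then 0 else 1)"
  proof (cases "u = u'")
    case True
    then have empty: "{(v, v') \<in> ancestors u \<times> ancestors u'. ?P v v'} = {}"
      using inj_on_parent_ancestors[OF u] by (blast dest: inj_onD)
    show ?thesis unfolding empty using True by simp
  next
    case False
    then obtain x y where single: "{(v, v') \<in> ancestors u \<times> ancestors u'. ?P v v'} = {(x, y)}"
      using unique_sibling_pair[OF u u'] anti by metis
    show ?thesis unfolding single using False by simp
  qed
  finally show ?thesis .
qed

lemma expectation_influence_square:
  assumes C: "finite C" "C \<subseteq> charged_vertices"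
    and anti: "\<And>u u'. u \<in> C \<Longrightarrow> u' \<in> C \<Longrightarrow> anc_le u u' \<Longrightarrow> u = u'"
  shows "expectation (\<lambda>\<omega>. (influence C i \<omega>)\<^sup>2) = asymptotic_variance C"
proof -
  let ?G = "\<lambda>u u' v v' \<omega>. mass u * mass u' * (rel_err v i \<omega> * rel_err v' i \<omega>)"
  have "(influence C i \<omega>)\<^sup>2 = (\<Sum>u\<in>C. \<Sum>u'\<in>C. \<Sum>v\<in>ancestors u. \<Sum>v'\<in>ancestors u'. ?G u u' v v' \<omega>)" for \<omega>
  proof -
    let ?a = "\<lambda>u. \<Sum>v\<in>ancestors u. rel_err v i \<omega>"
    have "(influence C i \<omega>)\<^sup>2 = (\<Sum>u\<in>C. \<Sum>u'\<in>C. (mass u * ?a u) * (mass u' * ?a u'))"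
      by (simp only: influence_def power2_eq_square sum_product)
    moreover have "(mass u * ?a u) * (mass u' * ?a u')
        = (\<Sum>v\<in>ancestors u. \<Sum>v'\<in>ancestors u'. ?G u u' v v' \<omega>)" for u u'
    proof -
      have "(mass u * ?a u) * (mass u' * ?a u') = mass u * mass u' * (?a u * ?a u')" by simp
      also have "\<dots> = mass u * mass u' * (\<Sum>v\<in>ancestors u. \<Sum>v'\<in>ancestors u'. rel_err v i \<omega> * rel_err v' i \<omega>)"
        by (simp only: sum_product)
      also have "\<dots> = (\<Sum>v\<in>ancestors u. \<Sum>v'\<in>ancestors u'. ?G u u' v v' \<omega>)"
        by (simp only: sum_distrib_left)
      finally show ?thesis .
    qed
    ultimately show ?thesis by simp
  qed
  moreover have "integrable M (\<lambda>\<omega>. rel_err v i \<omega> * rel_err v' i \<omega>)"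
      "expectation (\<lambda>\<omega>. rel_err v i \<omega> * rel_err v' i \<omega>) = cov v v'"
    if "u \<in> C" "u' \<in> C" "v \<in> ancestors u" "v' \<in> ancestors u'" for u u' v v'
  proof -
    have "v \<in> charged_vertices" "v \<noteq> root_vertex" "v' \<in> charged_vertices" "v' \<noteq> root_vertex"
      using that C ancestorsD[of u v] ancestorsD[of u' v'] by auto
    then show "integrable M (\<lambda>\<omega>. rel_err v i \<omega> * rel_err v' i \<omega>)"
        "expectation (\<lambda>\<omega>. rel_err v i \<omega> * rel_err v' i \<omega>) = cov v v'"
      using rel_err_mult_integrable[of v v' i] expectation_rel_err_mult[of v v' i] by blast+
  qed
  ultimately have "expectation (\<lambda>\<omega>. (influence C i \<omega>)\<^sup>2) =
      (\<Sum>u\<in>C. \<Sum>u'\<in>C. \<Sum>v\<in>ancestors u. \<Sum>v'\<in>ancestors u'. mass u * mass u' * cov v v')"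
    by (simp add: Bochner_Integration.integral_sum Bochner_Integration.integrable_sum)
  also have "\<dots> = (\<Sum>u\<in>C. \<Sum>u'\<in>C. mass u * mass u' * (\<Sum>v\<in>ancestors u. \<Sum>v'\<in>ancestors u'. cov v v'))"
    by (simp add: sum_distrib_left)
  also have "\<dots> = (\<Sum>u\<in>C. \<Sum>u'\<in>C. mass u * mass u' *
      ((\<Sum>v\<in>ancestors u \<inter> ancestors u'. (1 - ratio v) / ratio v) - (if u = u' then 0 else 1)))"
    (is "_ = (\<Sum>u\<in>C. \<Sum>u'\<in>C. ?h u u')")
  proof (intro sum.cong refl)
    fix u u' assume "u \<in> C" "u' \<in> C"
    moreover from this have "u \<in> vertices" "u' \<in> vertices" using C by (auto simp: charged_vertices_def)
    ultimately show "mass u * mass u' * (\<Sum>v\<in>ancestors u. \<Sum>v'\<in>ancestors u'. cov v v') = ?h u u'"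
      using anti[of u u'] anti[of u' u] by (subst sum_cov_ancestors) auto
  qed
  also have "\<dots> = (\<Sum>z\<in>C \<times> C. ?h (fst z) (snd z))"
    by (simp add: sum.cartesian_product case_prod_unfold)
  also have "C \<times> C = (\<lambda>u. (u, u)) ` C \<union> {(u, u'). u \<in> C \<and> u' \<in> C \<and> u \<noteq> u'}"
    by auto
  also have "(\<Sum>z\<in>\<dots>. ?h (fst z) (snd z)) = (\<Sum>z\<in>(\<lambda>u. (u, u)) ` C. ?h (fst z) (snd z))
      + (\<Sum>z\<in>{(u, u'). u \<in> C \<and> u' \<in> C \<and> u \<noteq> u'}. ?h (fst z) (snd z))"
  proof (rule sum.union_disjoint)
    show "finite {(u, u'). u \<in> C \<and> u' \<in> C \<and> u \<noteq> u'}"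
      by (rule finite_subset[of _ "C \<times> C"]) (use C in auto)
  qed (use C in auto)
  also have "(\<Sum>z\<in>(\<lambda>u. (u, u)) ` C. ?h (fst z) (snd z))
      = (\<Sum>u\<in>C. (mass u)\<^sup>2 * (\<Sum>v\<in>ancestors u. (1 - ratio v) / ratio v))"
    by (subst sum.reindex) (auto simp: inj_on_def power2_eq_square)
  also have "(\<Sum>z\<in>{(u, u'). u \<in> C \<and> u' \<in> C \<and> u \<noteq> u'}. ?h (fst z) (snd z))
      = (\<Sum>(u, u')\<in>{(u, u'). u \<in> C \<and> u' \<in> C \<and> u \<noteq> u'}. mass u * mass u' *
          ((\<Sum>v\<in>ancestors (common_ancestor u u'). (1 - ratio v) / ratio v) - 1))"
  proof (intro sum.cong refl)
    fix z assume "z \<in> {(u, u'). u \<in> C \<and> u' \<in> C \<and> u \<noteq> u'}"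
    then obtain u u' where z: "z = (u, u')" "u \<in> C" "u' \<in> C" "u \<noteq> u'" by blast
    then have "u \<in> vertices" "u' \<in> vertices" using C by (auto simp: charged_vertices_def)
    then show "?h (fst z) (snd z) = (case z of (u, u') \<Rightarrow> mass u * mass u' *
          ((\<Sum>v\<in>ancestors (common_ancestor u u'). (1 - ratio v) / ratio v) - 1))"
      using z by (simp add: ancestors_common_ancestor)
  qed
  finally show ?thesis by (simp add: asymptotic_variance_def)
qed

lemma influence_iid:
  assumes C: "finite C" "C \<subseteq> charged_vertices"
  shows "indep_vars (\<lambda>_. borel) (influence C) UNIV"
    and "distr M borel (influence C i) = distr M borel (influence C 0)"
proof -
  define H where "H f = (\<Sum>u\<in>C. mass u * (\<Sum>v\<in>ancestors u. (hit_of_row v f - ratio v) / ratio v))" for f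
  have "H \<in> borel_measurable (PiM charged_vertices (\<lambda>_. borel))"
    unfolding H_def
    by (intro borel_measurable_sum borel_measurable_times borel_measurable_divide
        borel_measurable_diff hit_of_row_measurable borel_measurable_const)
      (use C ancestorsD in blast)+
  note iid = row_function_iid[OF this]
  have eq: "influence C = (\<lambda>i \<omega>. H (row i \<omega>))"
  proof (intro ext)
    fix i \<omega>
    have "rel_err v i \<omega> = (hit_of_row v (row i \<omega>) - ratio v) / ratio v"
      if "u \<in> C" "v \<in> ancestors u" for u v
      using that C ancestorsD[of u v] hit_eq_row[of v i \<omega>] by (auto simp: rel_err_def)
    then show "influence C i \<omega> = H (row i \<omega>)"
      by (simp add: influence_def H_def)
  qed
  show "indep_vars (\<lambda>_. borel) (influence C) UNIV"
    "distr M borel (influence C i) = distr M borel (influence C 0)"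
    unfolding eq by (rule iid)+
qed

lemma influence_bounded:
  assumes C: "C \<subseteq> charged_vertices"
  shows "\<bar>influence C i \<omega>\<bar> \<le> (\<Sum>u\<in>C. mass u * (\<Sum>v\<in>ancestors u. 1 / ratio v))"
proof -
  have "\<bar>mass u * (\<Sum>v\<in>ancestors u. rel_err v i \<omega>)\<bar> \<le> mass u * (\<Sum>v\<in>ancestors u. 1 / ratio v)"
    if u: "u \<in> C" for u
  proof -
    have "\<bar>rel_err v i \<omega>\<bar> \<le> 1 / ratio v" if "v \<in> ancestors u" for v
    proof -
      have "v \<in> charged_vertices" "v \<noteq> root_vertex" using ancestorsD[of u v] C u that by auto
      then have q: "0 < ratio v" "ratio v \<le> 1" using ratio_pos ratio_le_1 by auto
      then have "\<bar>hit v i \<omega> - ratio v\<bar> \<le> 1" using hit_bounds[of v i \<omega>] by auto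
      then show ?thesis using q by (simp add: rel_err_def abs_divide divide_right_mono)
    qed
    then have "\<bar>\<Sum>v\<in>ancestors u. rel_err v i \<omega>\<bar> \<le> (\<Sum>v\<in>ancestors u. 1 / ratio v)"
      by (intro order_trans[OF sum_abs] sum_mono)
    moreover have "mass u \<ge> 0" by (simp add: cube_prob_def)
    ultimately show ?thesis by (simp add: abs_mult mult_left_mono)
  qed
  then show ?thesis
    unfolding influence_def by (intro order_trans[OF sum_abs] sum_mono)
qed

lemma influence_integrable:
  assumes "finite C" "C \<subseteq> charged_vertices"
  shows "integrable M (influence C i)"
proof (rule integrable_const_bound)
  show "AE \<omega> in M. norm (influence C i \<omega>) \<le> (\<Sum>u\<in>C. mass u * (\<Sum>v\<in>ancestors u. 1 / ratio v))"
    using influence_bounded[OF assms(2)] by simp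
  show "random_variable borel (influence C i)"
    using influence_iid(1)[OF assms] by (simp add: indep_vars_def)
qed

lemma expectation_influence:
  assumes C: "finite C" "C \<subseteq> charged_vertices"
  shows "expectation (influence C i) = 0"
proof -
  have "integrable M (rel_err v i) \<and> expectation (rel_err v i) = 0" if "u \<in> C" "v \<in> ancestors u" for u v
    using rel_err_integrable[of v i] expectation_rel_err[of v i] ancestorsD[of u v] that C by auto
  then show ?thesis
    unfolding influence_def[abs_def]
    by (simp add: Bochner_Integration.integral_sum Bochner_Integration.integrable_sum)
qed

section \<open>The linearisation error\<close>

definition remainder :: "nat \<Rightarrow> 'd vertex \<Rightarrow> 'a \<Rightarrow> real" where
  "remainder N u \<omega> = p_est Y N u \<omega> - mass u
     - mass u * (\<Sum>v\<in>ancestors u. (q_est Y N v \<omega> - ratio v) / ratio v)"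

lemma remainder_bound:
  assumes u: "u \<in> charged_vertices"
  shows "\<bar>remainder N u \<omega>\<bar> \<le> real (card (ancestors u)) * (\<Sum>v\<in>ancestors u. (q_est Y N v \<omega> - ratio v)\<^sup>2)"
proof -
  have fin: "finite (ancestors u)" using u by (simp add: charged_vertices_def finite_ancestors)
  have q: "0 < ratio v" "ratio v \<le> 1" if "v \<in> ancestors u" for v
    using ratio_pos ratio_le_1 ancestorsD[OF u that] by auto
  have "(\<Prod>w\<in>ancestors u - {v}. ratio w) = mass u / ratio v" if "v \<in> ancestors u" for v
    using prod.remove[OF fin that, of ratio] prod_ratio[OF u] q[OF that] by simp
  then have "(\<Sum>v\<in>ancestors u. (q_est Y N v \<omega> - ratio v) * (\<Prod>w\<in>ancestors u - {v}. ratio w))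
      = mass u * (\<Sum>v\<in>ancestors u. (q_est Y N v \<omega> - ratio v) / ratio v)"
    unfolding sum_distrib_left by (intro sum.cong) auto
  then have "\<bar>remainder N u \<omega>\<bar> \<le> (\<Sum>v\<in>ancestors u. \<bar>q_est Y N v \<omega> - ratio v\<bar>)\<^sup>2"
    using prod_linearization_error[OF fin, of "\<lambda>v. q_est Y N v \<omega>" ratio] q_est_bounds q
    by (simp add: remainder_def p_est_def prod_ratio[OF u] less_imp_le)
  also have "\<dots> \<le> (\<Sum>v\<in>ancestors u. \<bar>q_est Y N v \<omega> - ratio v\<bar>\<^sup>2) * real (card (ancestors u))"
    by (rule sum_squared_le_sum_of_squares)
  finally show ?thesis by (simp add: mult.commute)
qed

lemma remainder_integrable:
  assumes u: "u \<in> charged_vertices"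
  shows "integrable M (remainder N u)"
proof -
  have "integrable M (q_est Y N v)" if "v \<in> ancestors u" for v
    using q_est_rv[OF ancestorsD[OF u that]] q_est_bounds
    by (intro integrable_const_bound[where B = 1]) auto
  then show ?thesis
    unfolding remainder_def[abs_def] using p_est_integrable[OF u]
    by (intro Bochner_Integration.integrable_diff integrable_mult_right
        Bochner_Integration.integrable_sum integrable_divide) auto
qed

text \<open>
  The bound is of order \<open>1 / N\<close>, because each frequency has mean square error at most \<open>1 / N\<close>.
\<close>

lemma expectation_remainder:
  assumes u: "u \<in> charged_vertices" and N: "1 \<le> N"
  shows "expectation (\<lambda>\<omega>. \<bar>remainder N u \<omega>\<bar>) \<le> (real (card (ancestors u)))\<^sup>2 / real N"
proof -
  let ?Q = "\<lambda>v \<omega>. (q_est Y N v \<omega> - ratio v)\<^sup>2"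
  have int: "integrable M (?Q v)" if v: "v \<in> ancestors u" for v
  proof -
    note [measurable] = q_est_rv[OF ancestorsD[OF u v]]
    have "\<bar>q_est Y N v \<omega> - ratio v\<bar> \<le> 1" for \<omega>
      using q_est_bounds[of N v \<omega>] ratio_pos[of v] ratio_le_1[of v] ancestorsD[OF u v] by auto
    then show ?thesis
      by (intro integrable_const_bound[where B = 1]) (auto simp: abs_square_le_1)
  qed
  have "expectation (\<lambda>\<omega>. \<bar>remainder N u \<omega>\<bar>)
      \<le> expectation (\<lambda>\<omega>. real (card (ancestors u)) * (\<Sum>v\<in>ancestors u. ?Q v \<omega>))"
    using remainder_integrable[OF u] int
    by (intro integral_mono remainder_bound[OF u]) (auto intro!: Bochner_Integration.integrable_sum)
  also have "\<dots> = real (card (ancestors u)) * (\<Sum>v\<in>ancestors u. expectation (?Q v))"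
    using int by (simp add: Bochner_Integration.integral_sum)
  also have "\<dots> \<le> real (card (ancestors u)) * (\<Sum>v\<in>ancestors u. 1 / real N)"
    using ancestorsD[OF u] N by (intro mult_left_mono sum_mono q_est_mean_square) auto
  finally show ?thesis by (simp add: power2_eq_square)
qed

lemma sum_q_est_deviation:
  "(\<Sum>v\<in>ancestors u. (q_est Y N v \<omega> - ratio v) / ratio v) = (\<Sum>i<N. \<Sum>v\<in>ancestors u. rel_err v i \<omega>) / real N"
  if "1 \<le> N"
proof -
  have "(q_est Y N v \<omega> - ratio v) / ratio v = (\<Sum>i<N. rel_err v i \<omega>) / real N" for v
  proof -
    have "(\<Sum>i<N. rel_err v i \<omega>) = ((\<Sum>i<N. hit v i \<omega>) - real N * ratio v) / ratio v"
      by (simp add: rel_err_def sum_subtractf flip: sum_divide_distrib)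
    then show ?thesis
      using that by (simp add: q_est_eq field_simps)
  qed
  then show ?thesis
    by (simp add: sum.swap[of _ "ancestors u"] flip: sum_divide_distrib)
qed

section \<open>Estimators for an antichain of cubes\<close>

context
  fixes S :: "'d vertex set"
  assumes finite_S: "finite S" and S_vertices: "S \<subseteq> vertices"
    and antichain: "\<And>u u'. u \<in> S \<Longrightarrow> u' \<in> S \<Longrightarrow> anc_le u u' \<Longrightarrow> u = u'"
begin

lemma charged_eq: "charged M X S = S \<inter> charged_vertices"
  using S_vertices by (auto simp: charged_def charged_vertices_def)

lemma charged_finite: "finite (charged M X S)" and charged_subset: "charged M X S \<subseteq> charged_vertices"
  using finite_S by (auto simp: charged_eq)

lemma sum_mass_charged: "(\<Sum>u\<in>charged M X S. mass u) = (\<Sum>u\<in>S. mass u)"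
proof (rule sum.mono_neutral_left)
  show "\<forall>u\<in>S - charged M X S. mass u = 0"
    by (auto simp: charged_def cube_prob_def not_less measure_le_0_iff)
qed (use finite_S in \<open>auto simp: charged_def\<close>)

lemma p_est_set_integrable: "integrable M (p_est_set M X Y N S)"
  unfolding p_est_set_def[abs_def] using charged_subset p_est_integrable
  by (intro Bochner_Integration.integrable_sum) blast

theorem p_est_set_unbiased:
  assumes "1 \<le> N"
  shows "expectation (p_est_set M X Y N S) = (\<Sum>u\<in>S. mass u)"
proof -
  have "expectation (p_est_set M X Y N S) = (\<Sum>u\<in>charged M X S. expectation (p_est Y N u))"
    unfolding p_est_set_def[abs_def] using charged_subset p_est_integrable
    by (intro Bochner_Integration.integral_sum) blast
  also have "\<dots> = (\<Sum>u\<in>charged M X S. mass u)"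
    using charged_subset expectation_p_est[OF _ assms] by (intro sum.cong) auto
  finally show ?thesis by (simp add: sum_mass_charged)
qed

lemma q_est_tendsto_all:
  "AE \<omega> in M. \<forall>u\<in>charged M X S. \<forall>v\<in>ancestors u. (\<lambda>N. q_est Y N v \<omega>) \<longlonglongrightarrow> ratio v"
proof -
  have "AE \<omega> in M. (\<lambda>N. q_est Y N v \<omega>) \<longlonglongrightarrow> ratio v" if "u \<in> charged M X S" "v \<in> ancestors u" for u v
    using that charged_subset ancestorsD[of u v] by (intro q_est_tendsto) auto
  moreover have "finite (ancestors u)" if "u \<in> charged M X S" for u
    using that charged_subset by (intro finite_ancestors) (auto simp: charged_vertices_def)
  ultimately show ?thesis
    using charged_finite by (intro AE_finite_allI) auto
qed

theorem p_est_set_consistent: "AE \<omega> in M. (\<lambda>N. p_est_set M X Y N S \<omega>) \<longlonglongrightarrow> (\<Sum>u\<in>S. mass u)"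
  using q_est_tendsto_all
proof (rule AE_mp, intro AE_I2 impI)
  fix \<omega> assume "\<forall>u\<in>charged M X S. \<forall>v\<in>ancestors u. (\<lambda>N. q_est Y N v \<omega>) \<longlonglongrightarrow> ratio v"
  then show "(\<lambda>N. p_est_set M X Y N S \<omega>) \<longlonglongrightarrow> (\<Sum>u\<in>S. mass u)"
    unfolding p_est_set_def sum_mass_charged[symmetric]
    using charged_subset by (intro tendsto_sum p_est_tendsto) auto
qed

lemma asymptotic_variance_nonneg: "0 \<le> asymptotic_variance (charged M X S)"
proof -
  have "expectation (\<lambda>\<omega>. (influence (charged M X S) 0 \<omega>)\<^sup>2) = asymptotic_variance (charged M X S)"
    using antichain charged_finite charged_subset
    by (intro expectation_influence_square) (auto simp: charged_def)
  then show ?thesis by (metis integral_nonneg_AE AE_I2 zero_le_power2)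
qed

text \<open>
  The scaled error \<open>A\<close> differs from the normalised sum \<open>B\<close> of the i.i.d. influences by the scaled
  remainders, whose mean absolute value is at most \<open>K\<close> divided by the square root of \<open>N\<close>.
\<close>

theorem p_est_set_asymptotically_normal:
  "weak_conv_m (\<lambda>N. distr M borel (\<lambda>\<omega>. sqrt (real N) * (p_est_set M X Y N S \<omega> - (\<Sum>u\<in>S. mass u))))
     (centred_normal (sqrt (asymptotic_variance (charged M X S))))"
proof -
  let ?C = "charged M X S"
  let ?\<sigma> = "sqrt (asymptotic_variance ?C)"
  define A where "A N \<omega> = sqrt (real N) * (p_est_set M X Y N S \<omega> - (\<Sum>u\<in>S. mass u))" for N \<omega>
  define B where "B N \<omega> = (\<Sum>i<N. influence ?C i \<omega>) / sqrt (real N)" for N \<omega>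
  define K where "K = (\<Sum>u\<in>?C. (real (card (ancestors u)))\<^sup>2)"
  note C = charged_finite charged_subset
  have inf_rv [measurable]: "random_variable borel (influence ?C i)" for i
    using influence_integrable[OF C] by (rule borel_measurable_integrable)
  have p_rv [measurable]: "random_variable borel (p_est_set M X Y N S)" for N
    using p_est_set_integrable by (rule borel_measurable_integrable)
  have A_rv: "random_variable borel (A N)" and B_rv: "random_variable borel (B N)" for N
    unfolding A_def B_def by measurable
  have int: "integrable M (\<lambda>\<omega>. A N \<omega> - B N \<omega>)" for N
    unfolding A_def B_def using p_est_set_integrable influence_integrable[OF C]
    by (intro Bochner_Integration.integrable_diff integrable_mult_right integrable_divide
        Bochner_Integration.integrable_sum integrable_const) auto
  have diff: "A N \<omega> - B N \<omega> = sqrt (real N) * (\<Sum>u\<in>?C. remainder N u \<omega>)" if "1 \<le> N" for N \<omega>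
  proof -
    have "(\<Sum>i<N. influence ?C i \<omega>) / real N
        = (\<Sum>u\<in>?C. mass u * (\<Sum>v\<in>ancestors u. (q_est Y N v \<omega> - ratio v) / ratio v))"
      unfolding influence_def sum_q_est_deviation[OF that]
      by (simp add: sum.swap[of _ "{..<N}" ?C] sum_divide_distrib sum_distrib_left)
    then have "(\<Sum>u\<in>?C. remainder N u \<omega>)
        = p_est_set M X Y N S \<omega> - (\<Sum>u\<in>S. mass u) - (\<Sum>i<N. influence ?C i \<omega>) / real N"
      by (simp add: remainder_def sum_subtractf p_est_set_def sum_mass_charged)
    moreover have "sqrt (real N) * (x / real N) = x / sqrt (real N)" for x
      using that by (simp add: field_simps)
    ultimately show ?thesis
      by (simp only: right_diff_distrib A_def B_def)
  qed
  have L1: "expectation (\<lambda>\<omega>. \<bar>A N \<omega> - B N \<omega>\<bar>) \<le> K / sqrt (real N)" if "1 \<le> N" for N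
  proof -
    have rem: "integrable M (remainder N u)" if "u \<in> ?C" for u
      using that C by (intro remainder_integrable) auto
    have "expectation (\<lambda>\<omega>. \<bar>A N \<omega> - B N \<omega>\<bar>)
        \<le> expectation (\<lambda>\<omega>. sqrt (real N) * (\<Sum>u\<in>?C. \<bar>remainder N u \<omega>\<bar>))"
    proof (rule integral_mono)
      show "\<bar>A N \<omega> - B N \<omega>\<bar> \<le> sqrt (real N) * (\<Sum>u\<in>?C. \<bar>remainder N u \<omega>\<bar>)" for \<omega>
        using that by (simp add: diff abs_mult mult_left_mono)
    qed (use int rem in \<open>auto intro!: Bochner_Integration.integrable_sum\<close>)
    also have "\<dots> = sqrt (real N) * (\<Sum>u\<in>?C. expectation (\<lambda>\<omega>. \<bar>remainder N u \<omega>\<bar>))"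
      using rem by (simp add: Bochner_Integration.integral_sum)
    also have "\<dots> \<le> sqrt (real N) * (\<Sum>u\<in>?C. (real (card (ancestors u)))\<^sup>2 / real N)"
      using C that by (intro mult_left_mono sum_mono expectation_remainder) auto
    also have "\<dots> = K / sqrt (real N)"
      using that by (simp add: K_def field_simps flip: sum_divide_distrib)
    finally show ?thesis .
  qed
  have "weak_conv_m (\<lambda>N. distr M borel (A N)) (centred_normal ?\<sigma>)"
  proof (rule weak_conv_perturb[OF A_rv B_rv int])
    have bound_lim: "(\<lambda>N. K / sqrt (real N)) \<longlonglongrightarrow> 0"
      by (intro tendsto_divide_0[OF tendsto_const] filterlim_at_top_imp_at_infinity
          filterlim_compose[OF sqrt_at_top filterlim_real_sequentially])
    show "(\<lambda>N. expectation (\<lambda>\<omega>. \<bar>A N \<omega> - B N \<omega>\<bar>)) \<longlonglongrightarrow> 0"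
    proof (rule Lim_null_comparison[OF _ bound_lim])
      show "eventually (\<lambda>N. norm (expectation (\<lambda>\<omega>. \<bar>A N \<omega> - B N \<omega>\<bar>)) \<le> K / sqrt (real N)) sequentially"
        using eventually_ge_at_top[of 1] by eventually_elim (simp add: L1)
    qed
    show "real_distribution (centred_normal ?\<sigma>)"
      by (rule real_distribution_centred_normal) (simp add: asymptotic_variance_nonneg)
    fix t
    have "(\<lambda>N. char (distr M borel (B N)) t) \<longlonglongrightarrow> exp (- (?\<sigma> * t)\<^sup>2 / 2)"
      unfolding B_def
    proof (rule clt_char)
      show "indep_vars (\<lambda>_. borel) (influence ?C) UNIV"
        by (rule influence_iid(1)[OF C])
      show "expectation (\<lambda>\<omega>. (influence ?C i \<omega>)\<^sup>2) = ?\<sigma>\<^sup>2" for i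
        using antichain C asymptotic_variance_nonneg
        by (subst expectation_influence_square) (auto simp: charged_def)
      show "distr M borel (influence ?C i) = distr M borel (influence ?C 0)" for i
        by (rule influence_iid(2)[OF C])
    qed (use influence_bounded[OF C(2)] expectation_influence[OF C] asymptotic_variance_nonneg in auto)
    then show "(\<lambda>N. char (distr M borel (B N)) t) \<longlonglongrightarrow> char (centred_normal ?\<sigma>) t"
      by (subst char_centred_normal) (simp_all add: asymptotic_variance_nonneg)
  qed
  then show ?thesis by (simp add: A_def[abs_def])
qed

lemma var_est_set_consistent:
  "AE \<omega> in M. (\<lambda>N. var_est_set M X Y N S \<omega>) \<longlonglongrightarrow> asymptotic_variance (charged M X S)"
  using q_est_tendsto_all
proof (rule AE_mp, intro AE_I2 impI)
  fix \<omega> assume lim: "\<forall>u\<in>charged M X S. \<forall>v\<in>ancestors u. (\<lambda>N. q_est Y N v \<omega>) \<longlonglongrightarrow> ratio v"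
  let ?C = "charged M X S"
  have p: "(\<lambda>N. p_est Y N u \<omega>) \<longlonglongrightarrow> mass u" if "u \<in> ?C" for u
    using that lim charged_subset by (intro p_est_tendsto) auto
  have odds: "(\<lambda>N. (1 - q_est Y N v \<omega>) / q_est Y N v \<omega>) \<longlonglongrightarrow> (1 - ratio v) / ratio v"
    if "u \<in> ?C" "v \<in> ancestors u" for u v
  proof -
    have "ratio v \<noteq> 0"
      using that charged_subset ancestorsD[of u v] ratio_pos[of v] by auto
    then show ?thesis using that lim by (intro tendsto_intros) auto
  qed
  have pair: "(\<lambda>N. p_est Y N u \<omega> * p_est Y N u' \<omega> *
        ((\<Sum>v\<in>ancestors (common_ancestor u u'). (1 - q_est Y N v \<omega>) / q_est Y N v \<omega>) - 1))
      \<longlonglongrightarrow> mass u * mass u' * ((\<Sum>v\<in>ancestors (common_ancestor u u'). (1 - ratio v) / ratio v) - 1)"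
    if "u \<in> ?C" "u' \<in> ?C" for u u'
  proof -
    have "u \<in> vertices" "u' \<in> vertices"
      using that charged_subset by (auto simp: charged_vertices_def)
    then have "v \<in> ancestors u" if "v \<in> ancestors (common_ancestor u u')" for v
      using that by (simp add: ancestors_common_ancestor)
    with that show ?thesis
      by (intro tendsto_mult tendsto_diff tendsto_sum tendsto_const p odds[of u]) auto
  qed
  show "(\<lambda>N. var_est_set M X Y N S \<omega>) \<longlonglongrightarrow> asymptotic_variance ?C"
    unfolding var_est_set_def asymptotic_variance_def
    by (intro tendsto_add tendsto_sum tendsto_mult tendsto_power)
      (use p odds pair in \<open>auto intro!: tendsto_sum\<close>)
qed

lemma sd_est_set_rv: "random_variable borel (sd_est_set M X Y N S)"
proof -
  let ?C = "charged M X S"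
  have odds: "random_variable borel (\<lambda>\<omega>. (1 - q_est Y N v \<omega>) / q_est Y N v \<omega>)"
    if "u \<in> ?C" "v \<in> ancestors u" for u v
  proof -
    have [measurable]: "random_variable borel (q_est Y N v)"
      using that charged_subset ancestorsD[of u v] by (intro q_est_rv) auto
    show ?thesis by measurable
  qed
  have p: "random_variable borel (p_est Y N u)" if "u \<in> ?C" for u
    using that charged_subset p_est_rv[of u N] by auto
  have "random_variable borel (\<lambda>\<omega>. case z of (u, u') \<Rightarrow> p_est Y N u \<omega> * p_est Y N u' \<omega> *
        ((\<Sum>v\<in>ancestors (common_ancestor u u'). (1 - q_est Y N v \<omega>) / q_est Y N v \<omega>) - 1))"
    if z_in: "z \<in> {(u, u'). u \<in> ?C \<and> u' \<in> ?C \<and> u \<noteq> u'}" for z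
  proof -
    obtain u u' where z: "z = (u, u')" "u \<in> ?C" "u' \<in> ?C" using z_in by blast
    then have "u \<in> vertices" "u' \<in> vertices"
      using charged_subset by (auto simp: charged_vertices_def)
    then have "v \<in> ancestors u" if "v \<in> ancestors (common_ancestor u u')" for v
      using that by (simp add: ancestors_common_ancestor)
    with z show ?thesis
      unfolding z(1) prod.case
      by (intro borel_measurable_times borel_measurable_diff borel_measurable_sum
          borel_measurable_const p odds[of u]) auto
  qed
  moreover have "random_variable borel (\<lambda>\<omega>. (p_est Y N u \<omega>)\<^sup>2 *
        (\<Sum>v\<in>ancestors u. (1 - q_est Y N v \<omega>) / q_est Y N v \<omega>))" if "u \<in> ?C" for u
    using that by (intro borel_measurable_times borel_measurable_power borel_measurable_sum p odds[of u]) auto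
  ultimately have "random_variable borel (var_est_set M X Y N S)"
    unfolding var_est_set_def[abs_def] by (intro borel_measurable_add borel_measurable_sum) auto
  then show ?thesis
    unfolding sd_est_set_def[abs_def] by measurable
qed

theorem sd_est_set_consistent:
  "tendsto_in_prob M (\<lambda>N. sd_est_set M X Y N S) (sqrt (asymptotic_variance (charged M X S)))"
proof (rule tendsto_in_prob_if_AE[OF sd_est_set_rv])
  show "AE \<omega> in M. (\<lambda>N. sd_est_set M X Y N S \<omega>) \<longlonglongrightarrow> sqrt (asymptotic_variance (charged M X S))"
    using var_est_set_consistent unfolding sd_est_set_def
    by (rule AE_mp) (auto intro!: AE_I2 tendsto_real_sqrt)
qed

end

end

section \<open>The bounds of the dyadic algorithm\<close>

lemma density_on_unit_cube:
  fixes X :: "'a \<Rightarrow> real ^ 'd::finite"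
  assumes density: "distributed M (restrict_space lborel unit_cube) X f"
  shows "X \<in> measurable M (restrict_space borel unit_cube)"
    and "absolutely_continuous lborel (distr M borel X)"
proof -
  let ?R = "restrict_space lborel (unit_cube :: (real ^ 'd) set)"
  have cube: "unit_cube \<in> sets (borel :: (real ^ 'd) measure)"
    by (simp add: unit_cube_def)
  have XR: "X \<in> measurable M ?R"
    using density by (rule distributed_measurable)
  have "sets ?R = sets (restrict_space borel unit_cube)"
    by (rule sets_restrict_space_cong) simp
  with XR show R: "X \<in> measurable M (restrict_space borel unit_cube)"
    by (simp cong: measurable_cong_sets)
  then have X [measurable]: "X \<in> measurable M borel" and range: "\<And>\<omega>. \<omega> \<in> space M \<Longrightarrow> X \<omega> \<in> unit_cube"
    using cube by (auto simp: measurable_restrict_space2_iff)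
  have ac: "absolutely_continuous ?R (distr M ?R X)"
    using density distributed_borel_measurable[OF density]
    by (simp add: distributed_distr_eq_density absolutely_continuousI_density)
  show "absolutely_continuous lborel (distr M borel X)"
    unfolding absolutely_continuous_def
  proof
    fix A :: "(real ^ 'd) set" assume A: "A \<in> null_sets lborel"
    then have "A \<inter> unit_cube \<in> null_sets lborel"
      using cube by (intro null_set_Int2) auto
    then have "A \<inter> unit_cube \<in> null_sets ?R"
      using cube by (simp add: null_sets_restrict_space)
    then have "A \<inter> unit_cube \<in> null_sets (distr M ?R X)"
      using ac by (auto simp: absolutely_continuous_def)
    then have "X -` (A \<inter> unit_cube) \<inter> space M \<in> null_sets M"
      using XR by (simp add: null_sets_distr_iff)
    also have "X -` (A \<inter> unit_cube) \<inter> space M = X -` A \<inter> space M"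
      using range by auto
    finally show "A \<in> null_sets (distr M borel X)"
      using null_setsD2[OF A] by (simp add: null_sets_distr_iff)
  qed
qed

text \<open>
  Both \<open>I\<^sub>n\<close> and \<open>I\<^sub>n \<union> U\<^sub>n\<close> are finite antichains, with total masses \<open>p\<^sub>n\<^sup>-\<close> and \<open>p\<^sub>n\<^sup>+\<close>.
\<close>

theorem theorem2p4:
  fixes M :: "'a measure"
    and X :: "'a \<Rightarrow> real ^ 'd::finite"
    and f\<^sub>X :: "real ^ 'd \<Rightarrow> real"
    and g :: "real ^ 'd \<Rightarrow> real"
    and T L p :: real
    and enum :: "nat \<Rightarrow> 'd vertex list"
    and n :: nat
    and Y :: "'d vertex \<Rightarrow> nat \<Rightarrow> 'a \<Rightarrow> real ^ 'd"
  assumes "prob_space M"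
    and density: "distributed M (restrict_space lborel unit_cube) X (\<lambda>x. ennreal (f\<^sub>X x))"
    and density_nonneg: "\<forall>x\<in>unit_cube. 0 \<le> f\<^sub>X x"
    and density_bounded: "\<exists>B. \<forall>x\<in>unit_cube. f\<^sub>X x \<le> B"
    and lipschitz: "\<forall>x\<in>unit_cube. \<forall>y\<in>unit_cube. \<bar>g x - g y\<bar> \<le> L * infnorm (x - y)"
    and level_set: "\<exists>K>0. \<forall>\<delta>>0. measure lborel {x \<in> unit_cube. \<bar>g x - T\<bar> \<le> \<delta>} \<le> K * \<delta>"
    and p_def: "p = \<P>(\<omega> in M. g (X \<omega>) > T)"
    and p_in: "0 < p" "p < 1"
    and n_pos: "1 \<le> n"
    and enum: "\<And>j. distinct (enum j)" "\<And>j. set (enum j) = new_vertices g T L j"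
    and sample_law: "\<And>v i. v \<in> vertices \<Longrightarrow> cube_prob M X v > 0 \<Longrightarrow> 1 \<le> i \<Longrightarrow>
          distr M borel (Y v i) = uniform_measure (distr M borel X) (cube v)"
    and sample_indep: "prob_space.indep_vars M (\<lambda>_. borel) (\<lambda>(v, i). Y v i)
          ({v \<in> vertices. cube_prob M X v > 0} \<times> {1..})"
  defines "I\<^sub>n \<equiv> inside_cubes g T L enum n"
    and "U\<^sub>n \<equiv> undecided_cubes g T L enum n"
    and "p_minus \<equiv> p_lower M X g T L enum n"
    and "p_plus \<equiv> p_upper M X g T L enum n"
  shows
    "p_minus \<le> p \<and> p \<le> p_plus \<and>
     \<comment> \<open>unbiasedness\<close>
     (\<forall>N\<ge>1. integrable M (p_est_set M X Y N I\<^sub>n) \<and>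
        prob_space.expectation M (p_est_set M X Y N I\<^sub>n) = p_minus) \<and>
     (\<forall>N\<ge>1. integrable M (p_est_set M X Y N (I\<^sub>n \<union> U\<^sub>n)) \<and>
        prob_space.expectation M (p_est_set M X Y N (I\<^sub>n \<union> U\<^sub>n)) = p_plus) \<and>
     \<comment> \<open>strong consistency\<close>
     (AE \<omega> in M. (\<lambda>N. p_est_set M X Y N I\<^sub>n \<omega>) \<longlonglongrightarrow> p_minus) \<and>
     (AE \<omega> in M. (\<lambda>N. p_est_set M X Y N (I\<^sub>n \<union> U\<^sub>n) \<omega>) \<longlonglongrightarrow> p_plus) \<and>
     \<comment> \<open>asymptotic normality, and consistency of the estimators of the standard deviations\<close>
     (\<exists>\<sigma>_minus\<ge>0.
        weak_conv_m
          (\<lambda>N. distr M borel (\<lambda>\<omega>. sqrt (real N) * (p_est_set M X Y N I\<^sub>n \<omega> - p_minus)))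
          (centred_normal \<sigma>_minus) \<and>
        tendsto_in_prob M (\<lambda>N. sd_est_set M X Y N I\<^sub>n) \<sigma>_minus) \<and>
     (\<exists>\<sigma>_plus\<ge>0.
        weak_conv_m
          (\<lambda>N. distr M borel (\<lambda>\<omega>. sqrt (real N) * (p_est_set M X Y N (I\<^sub>n \<union> U\<^sub>n) \<omega> - p_plus)))
          (centred_normal \<sigma>_plus) \<and>
        tendsto_in_prob M (\<lambda>N. sd_est_set M X Y N (I\<^sub>n \<union> U\<^sub>n)) \<sigma>_plus)"
proof -
  interpret prob_space M by fact
  note X = density_on_unit_cube[OF density]
  have X_rv: "random_variable borel X" and X_range: "\<And>\<omega>. \<omega> \<in> space M \<Longrightarrow> X \<omega> \<in> unit_cube"
    using X(1) by (auto simp: measurable_restrict_space2_iff unit_cube_def)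
  interpret tree_sample M X Y
    using X_rv X_range X(2) sample_law sample_indep by unfold_locales auto
  interpret threshold_search g T L enum n
    using lipschitz enum(2) by unfold_locales auto
  define A where "A = {\<omega> \<in> space M. T < g (X \<omega>)}"
  have "L-lipschitz_on unit_cube g"
  proof (rule lipschitz_onI)
    fix x y :: "real ^ 'd" assume "x \<in> unit_cube" "y \<in> unit_cube"
    then have "\<bar>g x - g y\<bar> \<le> L * infnorm (x - y)" using lipschitz by blast
    also have "\<dots> \<le> L * norm (x - y)"
      using L_nonneg infnorm_le_norm by (rule mult_left_mono[rotated])
    finally show "dist (g x) (g y) \<le> L * dist x y" by (simp add: dist_norm)
  qed (rule L_nonneg)
  then have "g \<in> borel_measurable (restrict_space borel unit_cube)"
    by (intro borel_measurable_continuous_on_restrict lipschitz_on_continuous_on)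
  then have [measurable]: "random_variable borel (\<lambda>\<omega>. g (X \<omega>))"
    using measurable_compose[OF X(1)] by blast
  have A: "A \<in> events" unfolding A_def by measurable
  have p: "p = prob A" by (simp add: p_def A_def)
  have fin: "finite Ins" "finite Und" and sub: "Ins \<subseteq> vertices" "Ins \<union> Und \<subseteq> vertices"
    using finite_inside_undecided inside_undecided_vertices by auto
  have anti: "u = u'" if "u \<in> Ins \<union> Und" "u' \<in> Ins \<union> Und" "anc_le u u'" for u u'
    using inside_undecided_antichain that by blast
  have minus: "p_minus = (\<Sum>u\<in>Ins. mass u)"
    by (simp add: p_minus_def p_lower_def)
  have plus: "p_plus = (\<Sum>u\<in>Ins \<union> Und. mass u)"
    using fin inside_undecided_disjoint
    by (simp add: p_plus_def p_upper_def p_lower_def sum.union_disjoint)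
  have "p_minus \<le> p"
    unfolding minus p
  proof (rule sum_mass_le[OF fin(1) sub(1) _ A])
    show "u = u'" if "u \<in> Ins" "u' \<in> Ins" "anc_le u u'" for u u'
      using anti that by blast
    show "\<omega> \<in> A" if "v \<in> Ins" "\<omega> \<in> space M" "X \<omega> \<in> cube v" for v \<omega>
      using inside_above that by (simp add: A_def)
  qed
  moreover have "p \<le> p_plus"
    unfolding plus p
    by (rule prob_le_sum_mass) (use fin above_covered X_range in \<open>auto simp: A_def\<close>)
  moreover have est: "(\<forall>N\<ge>1. integrable M (p_est_set M X Y N S) \<and>
        expectation (p_est_set M X Y N S) = (\<Sum>u\<in>S. mass u)) \<and>
      (AE \<omega> in M. (\<lambda>N. p_est_set M X Y N S \<omega>) \<longlonglongrightarrow> (\<Sum>u\<in>S. mass u)) \<and>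
      (\<exists>\<sigma>\<ge>0. weak_conv_m
          (\<lambda>N. distr M borel (\<lambda>\<omega>. sqrt (real N) * (p_est_set M X Y N S \<omega> - (\<Sum>u\<in>S. mass u))))
          (centred_normal \<sigma>) \<and>
        tendsto_in_prob M (\<lambda>N. sd_est_set M X Y N S) \<sigma>)"
    if S: "finite S" "S \<subseteq> vertices" "\<And>u u'. u \<in> S \<Longrightarrow> u' \<in> S \<Longrightarrow> anc_le u u' \<Longrightarrow> u = u'" for S
  proof (intro conjI allI impI)
    show "integrable M (p_est_set M X Y N S)" for N
      by (rule p_est_set_integrable[OF S])
    show "expectation (p_est_set M X Y N S) = (\<Sum>u\<in>S. mass u)" if "1 \<le> N" for N
      by (rule p_est_set_unbiased[OF S that])
    show "AE \<omega> in M. (\<lambda>N. p_est_set M X Y N S \<omega>) \<longlonglongrightarrow> (\<Sum>u\<in>S. mass u)"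
      by (rule p_est_set_consistent[OF S])
    have "0 \<le> sqrt (asymptotic_variance (charged M X S))"
      using asymptotic_variance_nonneg[OF S] by simp
    then show "\<exists>\<sigma>\<ge>0. weak_conv_m
          (\<lambda>N. distr M borel (\<lambda>\<omega>. sqrt (real N) * (p_est_set M X Y N S \<omega> - (\<Sum>u\<in>S. mass u))))
          (centred_normal \<sigma>) \<and>
        tendsto_in_prob M (\<lambda>N. sd_est_set M X Y N S) \<sigma>"
      using p_est_set_asymptotically_normal[OF S] sd_est_set_consistent[OF S] by blast
  qed
  note est[OF fin(1) sub(1)] est[OF finite_UnI[OF fin] sub(2)]
  ultimately show ?thesis
    unfolding I\<^sub>n_def U\<^sub>n_def minus plus using anti by blast
qed

end
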